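(* Let $(A^{\rhd}, A^{\mathrm{Gr}})$ be an affinoid seminormed ring. Then the reified adic spectrum $\mathrm{Spra}(A^{\rhd}, A^{\mathrm{Gr}})$ is a spectral space, and its rational subspaces form a basis of its topology consisting of quasicompact open subsets.
   Context: A nonarchimedean seminormed ring is a commutative unital ring $A$ with a function $|\cdot|: A \to [0,\infty)$ such that $|0|=0$, $|x+y| \le \max\{|x|,|y|\}$ and $|xy| \le |x||y|$. For $r \in \mathbb{R}^+ := (0,\infty)$, let $A^{\circ,r}$ (resp. $A^{\circ\circ,r}$) be the set of $a \in A$ such that $r^{-n}|a^n|$ is bounded (resp. tends to $0$) as $n\to\infty$; put $\mathrm{Gr}\, A = \bigoplus_{r>0} A^{\circ,r}/A^{\circ\circ,r}$, a graded ring (multiplication sends degrees $r,s$ to degree $rs$). An affinoid seminormed ring is a pair $(A^{\rhd}, A^{\mathrm{Gr}})$ with $A^{\rhd}$ a nonarchimedean seminormed ring and $A^{\mathrm{Gr}}$ an integrally closed graded subring of $\mathrm{Gr}\, A^{\rhd}$; for $r>0$ let $A^{+,r}$ be the set of elements of $A^{\rhd,\circ,r}$ whose image in degree $r$ of $\mathrm{Gr}\,A^{\rhd}$ lies in $A^{\mathrm{Gr}}$. A value group is a totally ordered abelian group $\Gamma$ written multiplicatively; $\Gamma_0 = \Gamma \cup \{0\}$ with $0<\gamma$ for all $\gamma$. A semivaluation on a ring $A$ is a map $v: A \to \Gamma_0$ with $v(0)=0$, $v(1)=1$, $v(x+y)\le\max\{v(x),v(y)\}$, $v(xy)=v(x)v(y)$.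 A reified value group is a value group with an order-preserving homomorphism $\rho:\mathbb{R}^+\to\Gamma$ (for $q \in \mathbb{R}^+$ we write $q$ for $\rho(q)$); a reified semivaluation is a semivaluation with values in a reified value group. Let $\Gamma_v$ be the subgroup generated by $\rho(\mathbb{R}^+)$ and the nonzero values of $v$; two reified semivaluations are equivalent if there is an order-preserving group isomorphism $\Gamma_{v_1}\cong\Gamma_{v_2}$ compatible with the maps from $\mathbb{R}^+$ and carrying $v_1$ to $v_2$. $\mathrm{Sprv}(A)$ is the set of equivalence classes with topology generated by the sets $\{v: v(a) \le q v(b) \ne 0\}$ ($a,b\in A$, $q\in\mathbb{R}^+$). For $A$ a nonarchimedean seminormed ring, $v$ is bounded if $v(a)\le r$ whenever $a \in A^{\circ\circ,r}$; it is commensurable if it is bounded and for every $\gamma \in \Gamma_v$ there is $r \in \mathbb{R}^+$ with $r \le \gamma$. $\mathrm{Comm}(A) \subseteq \mathrm{Sprv}(A)$ is the subspace of commensurable classes. $\mathrm{Spra}(A^{\rhd},A^{\mathrm{Gr}})$ is the subspace of $\mathrm{Comm}(A^{\rhd})$ of those $v$ with $v(a)\le r$ for all $r\in\mathbb{R}^+$ and $a \in A^{+,r}$. A rational subspace of $\mathrm{Spra}(A^{\rhd},A^{\mathrm{Gr}})$ is its intersection with a set $\{v \in \mathrm{Sprv}(A^{\rhd}): v(f_i)\le q_i v(f_0) \ne 0\ (i=1,\dots,n)\}$ where $f_0,\dots,f_n\in A^{\rhd}$, $f_1,\dots,f_n$ generate the unit ideal, and $q_1,\dots,q_n>0$. A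 topological space is spectral if it is quasicompact, the quasicompact opens are closed under finite intersection and form a basis, and every irreducible closed subset has a unique generic point. *)

theory Defs
  imports "HOL-Analysis.Analysis" "HOL-Algebra.Algebra"
begin

section \<open>Nonarchimedean seminormed rings\<close>

record 'a seminormed_ring = "'a ring" +
  seminorm :: "'a \<Rightarrow> real"

locale nonarch_seminormed_ring = cring A for A :: "('a, 'm) seminormed_ring_scheme" (structure) +
  assumes seminorm_nonneg: "a \<in> carrier A \<Longrightarrow> 0 \<le> seminorm A a"
    and seminorm_zero: "seminorm A \<zero> = 0"
    and seminorm_add: "\<lbrakk>a \<in> carrier A; b \<in> carrier A\<rbrakk> \<Longrightarrow>
      seminorm A (a \<oplus> b) \<le> max (seminorm A a) (seminorm A b)"
    and seminorm_mult: "\<lbrakk>a \<in> carrier A; b \<in> carrier A\<rbrakk> \<Longrightarrow>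
      seminorm A (a \<otimes> b) \<le> seminorm A a * seminorm A b"

definition power_bounded :: "('a, 'm) seminormed_ring_scheme \<Rightarrow> real \<Rightarrow> 'a set" where
  "power_bounded A r =
     {a \<in> carrier A. Bseq (\<lambda>n::nat. seminorm A (a [^]\<^bsub>A\<^esub> n) / r ^ n)}"

definition top_nilpotent :: "('a, 'm) seminormed_ring_scheme \<Rightarrow> real \<Rightarrow> 'a set" where
  "top_nilpotent A r =
     {a \<in> carrier A. (\<lambda>n::nat. seminorm A (a [^]\<^bsub>A\<^esub> n) / r ^ n) \<longlonglongrightarrow> 0}"


section \<open>The graded ring of a seminormed ring\<close>

definition Gr_component :: "('a, 'm) seminormed_ring_scheme \<Rightarrow> real \<Rightarrow> 'a set monoid" where
  "Gr_component A r = ((add_monoid A)\<lparr>carrier := power_bounded A r\<rparr>) Mod top_nilpotent A r"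

definition Gr_homogeneous :: "('a, 'm) seminormed_ring_scheme \<Rightarrow> real \<Rightarrow> 'a set \<Rightarrow> (real \<Rightarrow> 'a set)"
  where "Gr_homogeneous A r c = (\<lambda>s\<in>{0<..}. if s = r then c else \<one>\<^bsub>Gr_component A s\<^esub>)"

text \<open>The summands below are the products of the nonzero components \<open>x r\<close> and \<open>y s\<close> with
  \<open>r * s = t\<close>; \<^const>\<open>rcoset_mult\<close> sends the cosets of \<open>a\<close> and \<open>b\<close> to the coset of
  \<open>a \<otimes> b\<close> modulo the topologically nilpotent elements of degree \<open>t\<close>. As the component of degree
  \<open>t\<close> is a multiplicatively written record, its addition is iterated by \<^const>\<open>finprod\<close>.\<close>

definition Gr_mult ::
  "('a, 'm) seminormed_ring_scheme \<Rightarrow> (real \<Rightarrow> 'a set) \<Rightarrow> (real \<Rightarrow> 'a set) \<Rightarrow> (real \<Rightarrow> 'a set)"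
  where "Gr_mult A x y = (\<lambda>t\<in>{0<..}.
     finprod (Gr_component A t) (\<lambda>(r, s). rcoset_mult A (top_nilpotent A t) (x r) (y s))
       {(r, s). 0 < r \<and> 0 < s \<and> r * s = t \<and>
          x r \<noteq> \<one>\<^bsub>Gr_component A r\<^esub> \<and> y s \<noteq> \<one>\<^bsub>Gr_component A s\<^esub>})"

definition Gr :: "('a, 'm) seminormed_ring_scheme \<Rightarrow> (real \<Rightarrow> 'a set) ring" where
  "Gr A = \<lparr>carrier = carrier (sum_group {0<..} (Gr_component A)),
           monoid.mult = Gr_mult A,
           monoid.one = Gr_homogeneous A 1 (top_nilpotent A 1 +>\<^bsub>A\<^esub> \<one>\<^bsub>A\<^esub>),
           ring.zero = \<one>\<^bsub>sum_group {0<..} (Gr_component A)\<^esub>,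
           ring.add = monoid.mult (sum_group {0<..} (Gr_component A))\<rparr>"

definition integral_over :: "('r, 'm) ring_scheme \<Rightarrow> 'r set \<Rightarrow> 'r \<Rightarrow> bool" where
  "integral_over R B x \<longleftrightarrow>
     (\<exists>(n::nat) b. b \<in> {..<n} \<rightarrow> B \<and>
        x [^]\<^bsub>R\<^esub> n \<oplus>\<^bsub>R\<^esub> (\<Oplus>\<^bsub>R\<^esub>i\<in>{..<n}. b i \<otimes>\<^bsub>R\<^esub> x [^]\<^bsub>R\<^esub> i) = \<zero>\<^bsub>R\<^esub>)"

definition integrally_closed_in :: "('r, 'm) ring_scheme \<Rightarrow> 'r set \<Rightarrow> bool" where
  "integrally_closed_in R B \<longleftrightarrow> (\<forall>x\<in>carrier R. integral_over R B x \<longrightarrow> x \<in> B)"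

locale affinoid_seminormed_ring = nonarch_seminormed_ring A
  for A :: "('a, 'm) seminormed_ring_scheme" (structure) +
  fixes B :: "(real \<Rightarrow> 'a set) set"
  assumes Gr_subring: "subring B (Gr A)"
    and graded: "\<lbrakk>x \<in> B; 0 < r\<rbrakk> \<Longrightarrow> Gr_homogeneous A r (x r) \<in> B"
    and integrally_closed: "integrally_closed_in (Gr A) B"

definition plus_part ::
  "('a, 'm) seminormed_ring_scheme \<Rightarrow> (real \<Rightarrow> 'a set) set \<Rightarrow> real \<Rightarrow> 'a set" where
  "plus_part A B r =
     {a \<in> power_bounded A r. Gr_homogeneous A r (top_nilpotent A r +>\<^bsub>A\<^esub> a) \<in> B}"


section \<open>Reified semivaluations\<close>

record 'g ordered_monoid = "'g monoid" +
  order_rel :: "'g rel"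

record 'g reified_monoid = "'g ordered_monoid" +
  reify :: "real \<Rightarrow> 'g"

locale value_group = comm_group G for G :: "('g, 'm) ordered_monoid_scheme" (structure) +
  assumes linear_order: "linear_order_on (carrier G) (order_rel G)"
    and mult_left_mono: "\<lbrakk>(x, y) \<in> order_rel G; z \<in> carrier G\<rbrakk> \<Longrightarrow> (z \<otimes> x, z \<otimes> y) \<in> order_rel G"

definition positive_reals :: "real monoid" where
  "positive_reals = \<lparr>carrier = {0<..}, monoid.mult = (*), one = 1\<rparr>"

text \<open>Order-preserving is read as weakly monotone, so \<open>reify G\<close> may be trivial.\<close>

locale reified_value_group = value_group G for G :: "'g reified_monoid" (structure) +
  assumes reify_hom: "reify G \<in> hom positive_reals G"
    and reify_mono: "\<lbrakk>0 < p; p \<le> q\<rbrakk> \<Longrightarrow> (reify G p, reify G q) \<in> order_rel G"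

text \<open>The monoid with zero attached to a value group is modelled by the option type, with
  \<^const>\<open>None\<close> as zero.\<close>

fun le0 :: "('g, 'm) ordered_monoid_scheme \<Rightarrow> 'g option \<Rightarrow> 'g option \<Rightarrow> bool" where
  "le0 G None y \<longleftrightarrow> True"
| "le0 G (Some g) None \<longleftrightarrow> False"
| "le0 G (Some g) (Some h) \<longleftrightarrow> (g, h) \<in> order_rel G"

definition max0 :: "('g, 'm) ordered_monoid_scheme \<Rightarrow> 'g option \<Rightarrow> 'g option \<Rightarrow> 'g option" where
  "max0 G x y = (if le0 G x y then y else x)"

fun mult0 :: "('g, 'm) monoid_scheme \<Rightarrow> 'g option \<Rightarrow> 'g option \<Rightarrow> 'g option" where
  "mult0 G (Some g) (Some h) = Some (g \<otimes>\<^bsub>G\<^esub> h)"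
| "mult0 G None y = None"
| "mult0 G (Some g) None = None"

definition semivaluation ::
  "('a, 'k) ring_scheme \<Rightarrow> ('g, 'm) ordered_monoid_scheme \<Rightarrow> ('a \<Rightarrow> 'g option) \<Rightarrow> bool" where
  "semivaluation A G v \<longleftrightarrow> value_group G \<and>
     v \<in> carrier A \<rightarrow> insert None (Some ` carrier G) \<and>
     v \<zero>\<^bsub>A\<^esub> = None \<and> v \<one>\<^bsub>A\<^esub> = Some \<one>\<^bsub>G\<^esub> \<and>
     (\<forall>x\<in>carrier A. \<forall>y\<in>carrier A. le0 G (v (x \<oplus>\<^bsub>A\<^esub> y)) (max0 G (v x) (v y))) \<and>
     (\<forall>x\<in>carrier A. \<forall>y\<in>carrier A. v (x \<otimes>\<^bsub>A\<^esub> y) = mult0 G (v x) (v y))"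

definition reified_semivaluation ::
  "('a, 'k) ring_scheme \<Rightarrow> 'g reified_monoid \<Rightarrow> ('a \<Rightarrow> 'g option) \<Rightarrow> bool" where
  "reified_semivaluation A G v \<longleftrightarrow> reified_value_group G \<and> semivaluation A G v"

definition value_subgroup ::
  "('a, 'k) ring_scheme \<Rightarrow> 'g reified_monoid \<Rightarrow> ('a \<Rightarrow> 'g option) \<Rightarrow> 'g set" where
  "value_subgroup A G v =
     generate G (reify G ` {0<..} \<union> {g. \<exists>a\<in>carrier A. v a = Some g})"

definition rsv_equivalent ::
  "('a, 'k) ring_scheme \<Rightarrow> 'g reified_monoid \<Rightarrow> ('a \<Rightarrow> 'g option) \<Rightarrow>
     'h reified_monoid \<Rightarrow> ('a \<Rightarrow> 'h option) \<Rightarrow> bool" where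
  "rsv_equivalent A G v H w \<longleftrightarrow>
     (\<exists>\<phi> \<in> iso (G\<lparr>carrier := value_subgroup A G v\<rparr>) (H\<lparr>carrier := value_subgroup A H w\<rparr>).
        (\<forall>x\<in>value_subgroup A G v. \<forall>y\<in>value_subgroup A G v.
           (x, y) \<in> order_rel G \<longrightarrow> (\<phi> x, \<phi> y) \<in> order_rel H) \<and>
        (\<forall>q>0. \<phi> (reify G q) = reify H q) \<and>
        (\<forall>a\<in>carrier A. map_option \<phi> (v a) = w a))"

lemma (in reified_value_group) reify_closed: "0 < q \<Longrightarrow> reify G q \<in> carrier G"
  using reify_hom by (auto simp: hom_def positive_reals_def)

lemma (in reified_value_group) reify_mult:
  "\<lbrakk>0 < p; 0 < q\<rbrakk> \<Longrightarrow> reify G (p * q) = reify G p \<otimes> reify G q"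
  using reify_hom by (auto simp: hom_def positive_reals_def)

lemma (in reified_value_group) reify_one: "reify G 1 = \<one>"
proof -
  have "reify G 1 \<otimes> reify G 1 = reify G 1"
    using reify_mult[OF zero_less_one zero_less_one] unfolding mult_1_left by (rule sym)
  then show ?thesis
    using l_cancel_one[OF reify_closed reify_closed, OF zero_less_one zero_less_one] by blast
qed

lemma rsv_value_closed:
  assumes "reified_semivaluation A G v" and a: "a \<in> carrier A" and g: "v a = Some g"
  shows "g \<in> carrier G"
proof -
  have "v \<in> carrier A \<rightarrow> insert None (Some ` carrier G)"
    using assms(1) by (simp add: reified_semivaluation_def semivaluation_def)
  from funcset_mem[OF this a] show ?thesis by (auto simp: g)
qed

lemma value_subgroup_is_subgroup:
  assumes "reified_semivaluation A G v"
  shows "subgroup (value_subgroup A G v) G"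
proof -
  interpret reified_value_group G using assms by (simp add: reified_semivaluation_def)
  have "{g. \<exists>a\<in>carrier A. v a = Some g} \<subseteq> carrier G"
  proof
    fix g assume "g \<in> {g. \<exists>a\<in>carrier A. v a = Some g}"
    then obtain a where "a \<in> carrier A" "v a = Some g" by (elim CollectE bexE)
    then show "g \<in> carrier G" by (rule rsv_value_closed[OF assms])
  qed
  moreover have "reify G ` {0<..} \<subseteq> carrier G"
    by (rule image_subsetI) (simp add: reify_closed)
  ultimately have "reify G ` {0<..} \<union> {g. \<exists>a\<in>carrier A. v a = Some g} \<subseteq> carrier G"
    by (rule Un_least[rotated])
  then show ?thesis
    unfolding value_subgroup_def by (rule generate_is_subgroup)
qed

lemma value_subgroup_fraction:
  fixes G :: "'g reified_monoid" (structure)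
  assumes A: "cring A" and v: "reified_semivaluation A G v" and \<gamma>: "\<gamma> \<in> value_subgroup A G v"
  shows "\<exists>q a b g h. 0 < q \<and> a \<in> carrier A \<and> b \<in> carrier A \<and> g \<in> carrier G \<and> h \<in> carrier G \<and>
    v a = Some g \<and> v b = Some h \<and> \<gamma> = reify G q \<otimes>\<^bsub>G\<^esub> (g \<otimes>\<^bsub>G\<^esub> inv\<^bsub>G\<^esub> h)"
proof -
  interpret A: cring A by fact
  interpret reified_value_group G using v by (simp add: reified_semivaluation_def)
  have v': "v \<in> carrier A \<rightarrow> insert None (Some ` carrier G)" "v \<one>\<^bsub>A\<^esub> = Some \<one>"
    and vm: "\<And>x y. x \<in> carrier A \<Longrightarrow> y \<in> carrier A \<Longrightarrow> v (x \<otimes>\<^bsub>A\<^esub> y) = mult0 G (v x) (v y)"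
    using v by (auto simp: reified_semivaluation_def semivaluation_def)
  have vc: "g \<in> carrier G" if "a \<in> carrier A" "v a = Some g" for a g
    using rsv_value_closed[OF v that] .
  let ?P = "\<lambda>\<gamma> q a b g h. 0 < q \<and> a \<in> carrier A \<and> b \<in> carrier A \<and> g \<in> carrier G \<and> h \<in> carrier G \<and>
    v a = Some g \<and> v b = Some h \<and> \<gamma> = reify G q \<otimes> (g \<otimes> inv h)"
  from \<gamma> show ?thesis
    unfolding value_subgroup_def
  proof (induction rule: generate.induct)
    case one
    have "?P \<one> 1 \<one>\<^bsub>A\<^esub> \<one>\<^bsub>A\<^esub> \<one> \<one>" using v' by (simp add: reify_one)
    then show ?case by (intro exI)
  next
    case (incl x)
    then consider q where "0 < q" "x = reify G q" | a where "a \<in> carrier A" "v a = Some x" by auto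
    then show ?case
    proof cases
      case 1
      then have "?P x q \<one>\<^bsub>A\<^esub> \<one>\<^bsub>A\<^esub> \<one> \<one>" using v' by (simp add: reify_closed)
      then show ?thesis by (intro exI)
    next
      case 2
      then have "?P x 1 a \<one>\<^bsub>A\<^esub> x \<one>" using v' vc[OF 2] by (simp add: reify_one)
      then show ?thesis by (intro exI)
    qed
  next
    case (inv x)
    then consider q where "0 < q" "x = reify G q" | a where "a \<in> carrier A" "v a = Some x" by auto
    then show ?case
    proof cases
      case 1
      have "reify G (1 / q) \<otimes> reify G q = \<one>"
        using 1 reify_mult[of "1 / q" q] by (simp add: reify_one)
      then have "inv x = reify G (1 / q)"
        using 1 by (intro inv_equality) (auto simp: reify_closed)
      then have "?P (inv x) (1 / q) \<one>\<^bsub>A\<^esub> \<one>\<^bsub>A\<^esub> \<one> \<one>"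
        using v' 1 by (simp add: reify_closed)
      then show ?thesis by (intro exI)
    next
      case 2
      then have "?P (inv x) 1 \<one>\<^bsub>A\<^esub> a \<one> x" using v' vc[OF 2] by (simp add: reify_one)
      then show ?thesis by (intro exI)
    qed
  next
    case (eng x y)
    from eng.IH(1) obtain q a b g h where 1: "?P x q a b g h" by (elim exE)
    from eng.IH(2) obtain q' a' b' g' h' where 2: "?P y q' a' b' g' h'" by (elim exE)
    have "?P (x \<otimes> y) (q * q') (a \<otimes>\<^bsub>A\<^esub> a') (b \<otimes>\<^bsub>A\<^esub> b') (g \<otimes> g') (h \<otimes> h')"
      using 1 2 by (simp add: vm reify_mult reify_closed inv_mult m_ac)
    then show ?case by (intro exI)
  qed
qed

lemma rsv_equivalent_sym:
  assumes v: "reified_semivaluation A G v" and w: "reified_semivaluation A H w"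
    and eq: "rsv_equivalent A G v H w"
  shows "rsv_equivalent A H w G v"
proof -
  let ?S = "value_subgroup A G v" and ?T = "value_subgroup A H w"
  interpret G: reified_value_group G using v by (simp add: reified_semivaluation_def)
  interpret H: reified_value_group H using w by (simp add: reified_semivaluation_def)
  have S: "subgroup ?S G" by (rule value_subgroup_is_subgroup[OF v])
  have linG: "(x, x) \<in> order_rel G" "(x, y) \<in> order_rel G \<or> (y, x) \<in> order_rel G"
    if "x \<in> ?S" "y \<in> ?S" for x y
    using G.linear_order subgroup.mem_carrier[OF S] that
    by (cases "x = y"; auto simp: order_on_defs refl_on_def total_on_def)+
  obtain \<phi> where \<phi>: "\<phi> \<in> iso (G\<lparr>carrier := ?S\<rparr>) (H\<lparr>carrier := ?T\<rparr>)"
    and ord: "\<And>x y. x \<in> ?S \<Longrightarrow> y \<in> ?S \<Longrightarrow> (x, y) \<in> order_rel G \<Longrightarrow> (\<phi> x, \<phi> y) \<in> order_rel H"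
    and reify: "\<And>q. 0 < q \<Longrightarrow> \<phi> (reify G q) = reify H q"
    and val: "\<And>a. a \<in> carrier A \<Longrightarrow> map_option \<phi> (v a) = w a"
    using eq unfolding rsv_equivalent_def by blast
  define \<psi> where "\<psi> = inv_into ?S \<phi>"
  have bij: "bij_betw \<phi> ?S ?T" using \<phi> by (simp add: iso_def)
  have \<psi>\<phi>: "\<psi> (\<phi> x) = x" if "x \<in> ?S" for x
    unfolding \<psi>_def using bij that by (simp add: bij_betw_def)
  have \<psi>: "\<psi> \<in> iso (H\<lparr>carrier := ?T\<rparr>) (G\<lparr>carrier := ?S\<rparr>)"
    using group.iso_set_sym[OF G.subgroup_imp_group[OF S] \<phi>] by (simp add: \<psi>_def)
  have reif: "reify G q \<in> ?S" if "0 < q" for q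
    unfolding value_subgroup_def by (rule generate.incl) (use that in auto)
  have vals: "g \<in> ?S" if "a \<in> carrier A" "v a = Some g" for a g
    unfolding value_subgroup_def by (rule generate.incl) (use that in auto)
  have "(\<psi> x, \<psi> y) \<in> order_rel G" if "x \<in> ?T" "y \<in> ?T" "(x, y) \<in> order_rel H" for x y
  proof -
    obtain a b where ab: "a \<in> ?S" "b \<in> ?S" "x = \<phi> a" "y = \<phi> b"
      using \<open>x \<in> ?T\<close> \<open>y \<in> ?T\<close> bij_betw_imp_surj_on[OF bij] by (metis imageE)
    show ?thesis
    proof (cases "(a, b) \<in> order_rel G")
      case False
      then have "(\<phi> b, \<phi> a) \<in> order_rel H" using ab linG(2) ord by blast
      moreover have "antisym (order_rel H)" using H.linear_order by (simp add: order_on_defs)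
      ultimately have "\<phi> a = \<phi> b" using that(3) ab by (auto dest: antisymD)
      then have "a = b" using ab \<psi>\<phi> by metis
      then show ?thesis using ab linG(1) \<psi>\<phi> by auto
    qed (use ab \<psi>\<phi> in auto)
  qed
  moreover have "\<psi> (reify H q) = reify G q" if "0 < q" for q
    using reify[OF that] \<psi>\<phi>[OF reif[OF that]] by simp
  moreover have "map_option \<psi> (w a) = v a" if "a \<in> carrier A" for a
    using val[OF that, symmetric] \<psi>\<phi> vals[OF that] by (cases "v a") simp_all
  ultimately show ?thesis
    unfolding rsv_equivalent_def by (intro bexI[OF _ \<psi>]) auto
qed

lemma rsv_equivalent_refl: "rsv_equivalent A G v G v"
  unfolding rsv_equivalent_def
  by (intro bexI[of _ id]) (auto simp: iso_def hom_def option.map_id)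

lemma rsv_equivalent_trans:
  assumes "rsv_equivalent A G v H w" and "rsv_equivalent A H w K u"
    and rG: "\<And>q. 0 < q \<Longrightarrow> reify G q \<in> value_subgroup A G v"
  shows "rsv_equivalent A G v K u"
proof -
  let ?S = "value_subgroup A G v" and ?T = "value_subgroup A H w" and ?U = "value_subgroup A K u"
  obtain \<phi> where \<phi>: "\<phi> \<in> iso (G\<lparr>carrier := ?S\<rparr>) (H\<lparr>carrier := ?T\<rparr>)"
    and o1: "\<And>x y. x \<in> ?S \<Longrightarrow> y \<in> ?S \<Longrightarrow> (x, y) \<in> order_rel G \<Longrightarrow> (\<phi> x, \<phi> y) \<in> order_rel H"
    and r1: "\<And>q. 0 < q \<Longrightarrow> \<phi> (reify G q) = reify H q"
    and v1: "\<And>a. a \<in> carrier A \<Longrightarrow> map_option \<phi> (v a) = w a"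
    using assms(1) unfolding rsv_equivalent_def by blast
  obtain \<psi> where \<psi>: "\<psi> \<in> iso (H\<lparr>carrier := ?T\<rparr>) (K\<lparr>carrier := ?U\<rparr>)"
    and o2: "\<And>x y. x \<in> ?T \<Longrightarrow> y \<in> ?T \<Longrightarrow> (x, y) \<in> order_rel H \<Longrightarrow> (\<psi> x, \<psi> y) \<in> order_rel K"
    and r2: "\<And>q. 0 < q \<Longrightarrow> \<psi> (reify H q) = reify K q"
    and v2: "\<And>a. a \<in> carrier A \<Longrightarrow> map_option \<psi> (w a) = u a"
    using assms(2) unfolding rsv_equivalent_def by blast
  have ST: "\<phi> x \<in> ?T" if "x \<in> ?S" for x
    using \<phi> that by (auto simp: iso_def bij_betw_def)
  have "\<psi> \<circ> \<phi> \<in> iso (G\<lparr>carrier := ?S\<rparr>) (K\<lparr>carrier := ?U\<rparr>)"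
    using iso_set_trans[OF \<phi> \<psi>] by (simp add: compose_def)
  then show ?thesis
    unfolding rsv_equivalent_def
    by (intro bexI[of _ "\<psi> \<circ> \<phi>"])
      (auto simp: o1 o2 ST r1 r2 option.map_comp[symmetric] v1 v2)
qed

lemma rsv_transport:
  fixes G :: "'g reified_monoid" (structure) and f :: "'g \<Rightarrow> 'h"
  assumes A: "cring A" and v: "reified_semivaluation A G v" and inj: "inj_on f (value_subgroup A G v)"
  shows "\<exists>(H :: 'h reified_monoid) w. reified_semivaluation A H w \<and> rsv_equivalent A G v H w"
proof -
  interpret A: cring A by (rule A)
  interpret reified_value_group G using v by (simp add: reified_semivaluation_def)
  let ?S = "value_subgroup A G v"
  have sub: "subgroup ?S G" by (rule value_subgroup_is_subgroup[OF v])
  have cS: "comm_group (G\<lparr>carrier := ?S\<rparr>)"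
    using sub by (intro group.group_comm_groupI subgroup_imp_group) (auto intro!: m_comm dest: subgroup.mem_carrier[OF sub])
  have Sc: "x \<in> carrier G" if "x \<in> ?S" for x using subgroup.subset[OF sub] that by blast
  have lin: "linear_order_on (carrier G) (order_rel G)" by (rule linear_order)
  have v': "v \<in> carrier A \<rightarrow> insert None (Some ` carrier G)" "v \<zero>\<^bsub>A\<^esub> = None" "v \<one>\<^bsub>A\<^esub> = Some \<one>"
    and va: "\<And>x y. x \<in> carrier A \<Longrightarrow> y \<in> carrier A \<Longrightarrow> le0 G (v (x \<oplus>\<^bsub>A\<^esub> y)) (max0 G (v x) (v y))"
    and vm: "\<And>x y. x \<in> carrier A \<Longrightarrow> y \<in> carrier A \<Longrightarrow> v (x \<otimes>\<^bsub>A\<^esub> y) = mult0 G (v x) (v y)"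
    using v by (auto simp: reified_semivaluation_def semivaluation_def)
  have rS: "reify G q \<in> ?S" if "0 < q" for q
    unfolding value_subgroup_def by (rule generate.incl) (use that in auto)
  have vS: "v a \<in> insert None (Some ` ?S)" if "a \<in> carrier A" for a
  proof (cases "v a")
    case (Some g)
    have "g \<in> ?S"
      unfolding value_subgroup_def by (rule generate.incl) (use that Some in auto)
    then show ?thesis using Some by auto
  qed auto
  define k where "k = the_inv_into ?S f"
  have kf [simp]: "k (f x) = x" if "x \<in> ?S" for x
    unfolding k_def by (rule the_inv_into_f_f[OF inj that])
  define H where "H = \<lparr>carrier = f ` ?S, monoid.mult = (\<lambda>x y. f (k x \<otimes> k y)), one = f \<one>,
    order_rel = {(f x, f y) | x y. x \<in> ?S \<and> y \<in> ?S \<and> (x, y) \<in> order_rel G},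
    reify = (\<lambda>q. f (reify G q))\<rparr>"
  define w where "w = (\<lambda>a. map_option f (v a))"
  have H_simps [simp]: "carrier H = f ` ?S" "\<one>\<^bsub>H\<^esub> = f \<one>" "reify H = (\<lambda>q. f (reify G q))"
    "\<And>x y. x \<otimes>\<^bsub>H\<^esub> y = f (k x \<otimes> k y)"
    by (simp_all add: H_def)
  have ordH: "(f x, f y) \<in> order_rel H \<longleftrightarrow> (x, y) \<in> order_rel G" if "x \<in> ?S" "y \<in> ?S" for x y
    using that inj by (auto simp: H_def inj_on_eq_iff)
  have ordH': "\<exists>x\<in>?S. \<exists>y\<in>?S. p = (f x, f y) \<and> (x, y) \<in> order_rel G" if "p \<in> order_rel H" for p
    using that by (auto simp: H_def)
  have mS: "x \<otimes> y \<in> ?S" if "x \<in> ?S" "y \<in> ?S" for x y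
    using that by (rule subgroup.m_closed[OF sub])
  have isoH: "f \<in> iso (G\<lparr>carrier := ?S\<rparr>) H"
    using inj mS by (auto simp: iso_def hom_def bij_betw_def)
  have "comm_group (H\<lparr>one := f \<one>\<^bsub>G\<lparr>carrier := ?S\<rparr>\<^esub>\<rparr>)"
    by (rule comm_group.iso_imp_img_comm_group[OF cS isoH])
  moreover have "H\<lparr>one := f \<one>\<^bsub>G\<lparr>carrier := ?S\<rparr>\<^esub>\<rparr> = H" by (simp add: H_def)
  ultimately have cH: "comm_group H" by metis
  interpret H: comm_group H by (rule cH)
  have linH: "linear_order_on (carrier H) (order_rel H)"
    unfolding order_on_defs
  proof (intro conjI)
    show "order_rel H \<subseteq> carrier H \<times> carrier H" using ordH' by fastforce
    show "refl_on (carrier H) (order_rel H)"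
      using lin Sc ordH by (auto simp: refl_on_def order_on_defs)
    show "trans (order_rel H)"
    proof (rule transI)
      fix x y z assume "(x, y) \<in> order_rel H" "(y, z) \<in> order_rel H"
      then obtain a b c d where "x = f a" "y = f b" "y = f c" "z = f d" "a \<in> ?S" "b \<in> ?S" "c \<in> ?S"
        "d \<in> ?S" "(a, b) \<in> order_rel G" "(c, d) \<in> order_rel G"
        using ordH'[of "(x, y)"] ordH'[of "(y, z)"] by auto
      moreover then have "b = c" using inj by (auto dest: inj_onD)
      ultimately show "(x, z) \<in> order_rel H"
        using lin ordH by (auto simp: order_on_defs dest: transD)
    qed
    show "antisym (order_rel H)"
    proof (rule antisymI)
      fix x y assume *: "(x, y) \<in> order_rel H" "(y, x) \<in> order_rel H"
      then obtain a b where "x = f a" "y = f b" "a \<in> ?S" "b \<in> ?S"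
        using ordH'[of "(x, y)"] by auto
      then show "x = y"
        using lin * ordH by (auto simp: order_on_defs dest: antisymD)
    qed
    show "total_on (carrier H) (order_rel H)"
      using lin Sc ordH by (simp add: total_on_def order_on_defs) metis
  qed
  have rvgH: "reified_value_group H"
  proof unfold_locales
    show "linear_order_on (carrier H) (order_rel H)" by (rule linH)
    show "(z \<otimes>\<^bsub>H\<^esub> x, z \<otimes>\<^bsub>H\<^esub> y) \<in> order_rel H" if "(x, y) \<in> order_rel H" "z \<in> carrier H" for x y z
      using ordH'[OF that(1)] that(2) mult_left_mono Sc by (auto simp: ordH mS)
    show "reify H \<in> hom positive_reals H"
      by (auto simp: hom_def positive_reals_def rS reify_mult)
    show "(reify H p, reify H q) \<in> order_rel H" if "0 < p" "p \<le> q" for p q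
      using that reify_mono[OF that] by (simp add: ordH rS)
  qed
  have le0H: "le0 H (map_option f x) (map_option f y) \<longleftrightarrow> le0 G x y"
    if "x \<in> insert None (Some ` ?S)" "y \<in> insert None (Some ` ?S)" for x y
    using that ordH by auto
  have max0H: "max0 H (map_option f x) (map_option f y) = map_option f (max0 G x y)"
    if "x \<in> insert None (Some ` ?S)" "y \<in> insert None (Some ` ?S)" for x y
    using le0H[OF that] by (simp add: max0_def)
  have max0S: "max0 G x y \<in> insert None (Some ` ?S)"
    if "x \<in> insert None (Some ` ?S)" "y \<in> insert None (Some ` ?S)" for x y
    using that by (auto simp: max0_def)
  have mult0H: "mult0 H (map_option f x) (map_option f y) = map_option f (mult0 G x y)"
    if "x \<in> insert None (Some ` ?S)" "y \<in> insert None (Some ` ?S)" for x y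
    using that by auto
  have sv: "semivaluation A H w"
    unfolding semivaluation_def
  proof (intro conjI ballI)
    show "value_group H" using rvgH by (rule reified_value_group.axioms(1))
    show "w \<in> carrier A \<rightarrow> insert None (Some ` carrier H)"
      using vS by (fastforce simp: w_def)
    show "le0 H (w (x \<oplus>\<^bsub>A\<^esub> y)) (max0 H (w x) (w y))" if "x \<in> carrier A" "y \<in> carrier A" for x y
      unfolding w_def max0H[OF vS[OF that(1)] vS[OF that(2)]]
      using va[OF that] le0H[OF vS max0S[OF vS[OF that(1)] vS[OF that(2)]]] that by simp
    show "w (x \<otimes>\<^bsub>A\<^esub> y) = mult0 H (w x) (w y)" if "x \<in> carrier A" "y \<in> carrier A" for x y
      unfolding w_def vm[OF that] using mult0H[OF vS vS, OF that] by simp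
  qed (simp_all add: w_def v')
  have "rsv_equivalent A G v H w"
  proof -
    have gen: "generate H (f ` (reify G ` {0<..} \<union> {g. \<exists>a\<in>carrier A. v a = Some g})) = f ` ?S"
      (is "generate H (f ` ?K) = _")
    proof -
      have K: "?K \<subseteq> ?S" unfolding value_subgroup_def by (auto intro: generate.incl)
      interpret f: group_hom "G\<lparr>carrier := ?S\<rparr>" H f
        using isoH cS H.is_group by (auto simp: group_hom_def group_hom_axioms_def iso_def comm_group_def)
      have "generate H (f ` ?K) = f ` generate (G\<lparr>carrier := ?S\<rparr>) ?K"
        using K by (intro f.generate_img) simp
      also have "generate (G\<lparr>carrier := ?S\<rparr>) ?K = ?S"
        using generate_consistent[OF K sub] by (simp add: value_subgroup_def)
      finally show ?thesis .
    qed
    have "value_subgroup A H w = f ` ?S"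
      unfolding gen[symmetric] by (auto simp: value_subgroup_def w_def image_Un intro!: arg_cong[where f = "generate H"])
    then have "H\<lparr>carrier := value_subgroup A H w\<rparr> = H" by (simp add: H_def)
    then show ?thesis
      unfolding rsv_equivalent_def
      by (intro bexI[of _ f]) (use isoH ordH in \<open>auto simp: w_def\<close>)
  qed
  moreover have "reified_semivaluation A H w"
    unfolding reified_semivaluation_def by (rule conjI[OF rvgH sv])
  ultimately show ?thesis by blast
qed

lemma rsv_small_representative:
  fixes A :: "('a, 'k) ring_scheme"
  assumes A: "cring A" and v: "reified_semivaluation A G v"
  shows "\<exists>(H :: (real \<times> 'a \<times> 'a) reified_monoid) w.
    reified_semivaluation A H w \<and> rsv_equivalent A G v H w"
proof -
  define f where "f = (\<lambda>\<gamma>. SOME (q, a, b). \<gamma> =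
    reify G q \<otimes>\<^bsub>G\<^esub> (the (v a) \<otimes>\<^bsub>G\<^esub> inv\<^bsub>G\<^esub> the (v b)))"
  have f: "case f \<gamma> of (q, a, b) \<Rightarrow> \<gamma> = reify G q \<otimes>\<^bsub>G\<^esub> (the (v a) \<otimes>\<^bsub>G\<^esub> inv\<^bsub>G\<^esub> the (v b))"
    if \<gamma>: "\<gamma> \<in> value_subgroup A G v" for \<gamma>
    unfolding f_def
  proof (rule someI_ex)
    obtain q a b g h where *: "v a = Some g" "v b = Some h"
      "\<gamma> = reify G q \<otimes>\<^bsub>G\<^esub> (g \<otimes>\<^bsub>G\<^esub> inv\<^bsub>G\<^esub> h)"
      using value_subgroup_fraction[OF A v \<gamma>] by blast
    show "\<exists>x. case x of (q, a, b) \<Rightarrow>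
        \<gamma> = reify G q \<otimes>\<^bsub>G\<^esub> (the (v a) \<otimes>\<^bsub>G\<^esub> inv\<^bsub>G\<^esub> the (v b))"
      by (rule exI[of _ "(q, a, b)"]) (simp add: *)
  qed
  have "inj_on f (value_subgroup A G v)"
  proof (rule inj_onI)
    fix x y assume x: "x \<in> value_subgroup A G v" and y: "y \<in> value_subgroup A G v" and "f x = f y"
    obtain q a b where fx: "f x = (q, a, b)" by (cases "f x")
    then have fy: "f y = (q, a, b)" using \<open>f x = f y\<close> by simp
    have "x = reify G q \<otimes>\<^bsub>G\<^esub> (the (v a) \<otimes>\<^bsub>G\<^esub> inv\<^bsub>G\<^esub> the (v b))"
      using f[OF x] unfolding fx prod.case .
    also have "\<dots> = y" using f[OF y] unfolding fy prod.case by (rule sym)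
    finally show "x = y" .
  qed
  from rsv_transport[OF A v this] show ?thesis .
qed


section \<open>The reified valuation spectrum\<close>

text \<open>Every element of \<open>value_subgroup A G v\<close> has the form \<open>q v(a) / v(b)\<close>, so every reified
  semivaluation is equivalent to one whose value group has elements of type
  \<^typ>\<open>real \<times> 'a \<times> 'a\<close> (lemma \<open>rsv_small_representative\<close>). Restricting to this type turns
  the equivalence classes into a set without losing any of them.\<close>

type_synonym 'a small_rsv = "(real \<times> 'a \<times> 'a) reified_monoid \<times> ('a \<Rightarrow> (real \<times> 'a \<times> 'a) option)"

definition small_rsvs :: "('a, 'k) ring_scheme \<Rightarrow> 'a small_rsv set" where
  "small_rsvs A = {(G, v). reified_semivaluation A G v}"

definition rsv_rel :: "('a, 'k) ring_scheme \<Rightarrow> 'a small_rsv rel" where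
  "rsv_rel A = {((G, v), (H, w)). (G, v) \<in> small_rsvs A \<and> (H, w) \<in> small_rsvs A \<and>
                  rsv_equivalent A G v H w}"

lemma equiv_rsv_rel:
  fixes A :: "('a, 'k) ring_scheme"
  shows "equiv (small_rsvs A) (rsv_rel A)"
proof (rule equivI)
  show "rsv_rel A \<subseteq> small_rsvs A \<times> small_rsvs A" by (auto simp: rsv_rel_def)
  show "refl_on (small_rsvs A) (rsv_rel A)"
    by (auto simp: refl_on_def rsv_rel_def rsv_equivalent_refl)
  show "sym (rsv_rel A)"
    by (auto simp: sym_def rsv_rel_def small_rsvs_def intro: rsv_equivalent_sym)
  have reif: "reify G q \<in> value_subgroup A G v" if "0 < q" for G q and v :: "'a \<Rightarrow> (real \<times> 'a \<times> 'a) option"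
    unfolding value_subgroup_def by (rule generate.incl) (use that in auto)
  show "trans (rsv_rel A)"
    unfolding trans_def rsv_rel_def using rsv_equivalent_trans reif by blast
qed

definition Sprv_set :: "('a, 'k) ring_scheme \<Rightarrow> 'a small_rsv set set" where
  "Sprv_set A = small_rsvs A // rsv_rel A"

text \<open>The condition \<open>v(a) \<le> q v(b) \<noteq> 0\<close>. Like the other conditions imposed on classes below, it
  does not depend on the representative.\<close>

definition dominated ::
  "'g reified_monoid \<Rightarrow> ('a \<Rightarrow> 'g option) \<Rightarrow> 'a \<Rightarrow> real \<Rightarrow> 'a \<Rightarrow> bool" where
  "dominated G v a q b \<longleftrightarrow> le0 G (v a) (mult0 G (Some (reify G q)) (v b)) \<and> v b \<noteq> None"

definition Sprv :: "('a, 'k) ring_scheme \<Rightarrow> 'a small_rsv set topology" where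
  "Sprv A = topology_generated_by
     {{c \<in> Sprv_set A. \<exists>(G, v)\<in>c. dominated G v a q b} | a b q.
        a \<in> carrier A \<and> b \<in> carrier A \<and> 0 < q}"


section \<open>Commensurable semivaluations and the reified adic spectrum\<close>

definition bounded_rsv ::
  "('a, 'm) seminormed_ring_scheme \<Rightarrow> 'g reified_monoid \<Rightarrow> ('a \<Rightarrow> 'g option) \<Rightarrow> bool" where
  "bounded_rsv A G v \<longleftrightarrow> (\<forall>r>0. \<forall>a\<in>top_nilpotent A r. le0 G (v a) (Some (reify G r)))"

definition commensurable_rsv ::
  "('a, 'm) seminormed_ring_scheme \<Rightarrow> 'g reified_monoid \<Rightarrow> ('a \<Rightarrow> 'g option) \<Rightarrow> bool" where
  "commensurable_rsv A G v \<longleftrightarrow> bounded_rsv A G v \<and>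
     (\<forall>\<gamma>\<in>value_subgroup A G v. \<exists>r>0. (reify G r, \<gamma>) \<in> order_rel G)"

definition Comm :: "('a, 'm) seminormed_ring_scheme \<Rightarrow> 'a small_rsv set topology" where
  "Comm A = subtopology (Sprv A) {c. \<exists>(G, v)\<in>c. commensurable_rsv A G v}"

definition Spra ::
  "('a, 'm) seminormed_ring_scheme \<Rightarrow> (real \<Rightarrow> 'a set) set \<Rightarrow> 'a small_rsv set topology" where
  "Spra A B = subtopology (Comm A)
     {c. \<exists>(G, v)\<in>c. \<forall>r>0. \<forall>a\<in>plus_part A B r. le0 G (v a) (Some (reify G r))}"

definition rational_subspaces ::
  "('a, 'm) seminormed_ring_scheme \<Rightarrow> (real \<Rightarrow> 'a set) set \<Rightarrow> 'a small_rsv set set set" where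
  "rational_subspaces A B =
     {topspace (Spra A B) \<inter>
        {c \<in> Sprv_set A. \<exists>(G, v)\<in>c. \<forall>i\<in>{1..n}. dominated G v (f i) (q i) (f 0)} | (n::nat) f q.
        f \<in> {0..n} \<rightarrow> carrier A \<and> Idl\<^bsub>A\<^esub> (f ` {1..n}) = carrier A \<and> (\<forall>i\<in>{1..n}. 0 < q i)}"


section \<open>Spectral spaces\<close>

definition irreducible_in :: "'x topology \<Rightarrow> 'x set \<Rightarrow> bool" where
  "irreducible_in T Z \<longleftrightarrow> Z \<subseteq> topspace T \<and> Z \<noteq> {} \<and>
     (\<forall>C D. closedin T C \<and> closedin T D \<and> Z \<subseteq> C \<union> D \<longrightarrow> Z \<subseteq> C \<or> Z \<subseteq> D)"

definition spectral_space :: "'x topology \<Rightarrow> bool" where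
  "spectral_space T \<longleftrightarrow>
     compact_space T \<and>
     (\<forall>U V. openin T U \<and> compactin T U \<and> openin T V \<and> compactin T V \<longrightarrow> compactin T (U \<inter> V)) \<and>
     openin T = arbitrary union_of (\<lambda>U. openin T U \<and> compactin T U) \<and>
     (\<forall>Z. closedin T Z \<and> irreducible_in T Z \<longrightarrow>
        (\<exists>!x. x \<in> topspace T \<and> Abstract_Topology.closure_of T {x} = Z))"

end

theory Submission
  imports Defs
begin

text \<open>A space with a base closed under intersections is spectral, with compact base sets, as soon as
  the base separates points and every ultrafilter \<open>F\<close> has a limit \<open>x\<close>, in the strong sense that
  \<open>x\<close> lies in a base set exactly if that set belongs to \<open>F\<close>. For the rational subspaces of the
  reified adic spectrum, the limit is the ultraproduct of the semivaluations along \<open>F\<close>, in which all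
  values smaller than every positive real are replaced by zero; this makes it commensurable. The
  replacement does not affect membership in rational subspaces: if \<open>v(f\<^sub>i) \<le> q\<^sub>i v(f\<^sub>0)\<close> and the \<open>f\<^sub>i\<close>
  generate the unit ideal, then \<open>v(f\<^sub>0)\<close> is bounded below by a positive real, as the elements that are
  dominated by a real multiple of \<open>f\<^sub>0\<close> form an ideal.\<close>

section \<open>Ultrafilter limits and spectral spaces\<close>

text \<open>A class of semivaluations is handled through the relation
  \<open>dominated G v a q b\<close> alone: it does not depend on the representative, it determines
  the class, and every condition that defines the spectrum can be stated in it. So points with
  unrelated value groups can be compared, and a limit is known once its relation is known. The
  obstacle is commensurability. Bounds v(a) \<le> r survive an ultraproduct, but the existence of a
  positive real below each nonzero value does not, as the real may vary with the index. Values can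
  escape only downwards: at every point v(a) is at most |a| + 1, so no value of a ring element in
  the ultraproduct exceeds all reals. Therefore the elements whose values escape form a prime ideal,
  which can serve as the support of the limit. The price is that v(b) may be nonzero at almost all
  points and zero in the limit, so that a set v(a) \<le> q v(b) \<noteq> 0 can miss the limit of its
  points. Finally, the ultraproduct has functions as values, and must be traded for an equivalent
  semivaluation of the small type of which points are made.\<close>

locale ultrafilter =
  fixes F :: "'i filter"
  assumes proper: "F \<noteq> bot"
    and ultra: "eventually P F \<or> (\<forall>\<^sub>F i in F. \<not> P i)"
begin

lemma not_eventually_iff: "\<not> eventually P F \<longleftrightarrow> (\<forall>\<^sub>F i in F. \<not> P i)"
  using ultra[of P] eventually_conj[of P F "\<lambda>i. \<not> P i"] proper by auto

end

section \<open>Existence of ultrafilters\<close>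

lemma ultrafilter_exists:
  fixes F :: "'i filter"
  assumes "F \<noteq> bot"
  obtains U where "U \<le> F" "ultrafilter U"
proof -
  define S where "S = {G. G \<noteq> bot \<and> G \<le> F}"
  \<comment> \<open>Finer filters are smaller in the order of filters, so Zorn is applied to the
    reversed order and yields a minimal proper filter.\<close>
  have "\<exists>U\<in>S. \<forall>G\<in>S. U \<ge> G \<longrightarrow> G = U"
  proof (rule predicate_Zorn)
    show "partial_order_on S (relation_of (\<ge>) S)"
      by (auto simp: partial_order_on_def preorder_on_def refl_on_def relation_of_def trans_def antisym_def)
  next
    fix C assume C: "C \<in> Chains (relation_of (\<ge>) S)"
    show "\<exists>U\<in>S. \<forall>G\<in>C. G \<ge> U"
    proof (cases "C = {}")
      case True
      then show ?thesis using assms by (auto simp: S_def)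
    next
      case False
      have CS: "C \<subseteq> S" using C by (auto simp: Chains_def relation_of_def)
      have "\<exists>H\<in>C. H \<le> inf G G'" if "G \<in> C" "G' \<in> C" for G G'
        using C that by (fastforce simp: Chains_def relation_of_def)
      then have "eventually P (Inf C) \<longleftrightarrow> (\<exists>G\<in>C. eventually P G)" for P
        using eventually_Inf_base[OF False] by blast
      moreover have "\<not> eventually (\<lambda>_. False) G" if "G \<in> C" for G
        using CS that by (auto simp: S_def trivial_limit_def)
      ultimately have "Inf C \<noteq> bot" by (auto simp: trivial_limit_def)
      moreover have "Inf C \<le> F" using CS False by (auto simp: S_def intro: Inf_lower2)
      ultimately show ?thesis by (auto simp: S_def intro!: bexI[of _ "Inf C"] Inf_lower)
    qed
  qed
  then obtain U where U: "U \<noteq> bot" "U \<le> F" and max: "\<And>G. G \<noteq> bot \<Longrightarrow> G \<le> U \<Longrightarrow> G = U"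
    unfolding S_def by (metis (mono_tags, lifting) mem_Collect_eq order_trans)
  have "ultrafilter U"
  proof
    show "eventually P U \<or> (\<forall>\<^sub>F i in U. \<not> P i)" for P
    \<comment> \<open>Restricting \<open>U\<close> to \<open>P\<close> gives a finer filter: either
      it is \<open>bot\<close>, and then the negation of \<open>P\<close> is eventual, or it equals
      \<open>U\<close> by minimality.\<close>
    proof (cases "inf U (principal {i. P i}) = bot")
      case True
      then show ?thesis by (simp add: trivial_limit_def eventually_inf_principal)
    next
      case False
      then have "inf U (principal {i. P i}) = U" using max by simp
      then have "U \<le> principal {i. P i}" by (simp add: inf.absorb_iff1)
      then show ?thesis by (simp add: le_principal)
    qed
  qed fact
  with U(2) show thesis by (rule that)
qed

lemma ultrafilter_of_family:
  fixes S :: "'i set set"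
  assumes fip: "\<And>T. finite T \<Longrightarrow> T \<subseteq> S \<Longrightarrow> \<Inter>T \<noteq> {}"
  shows "\<exists>U. ultrafilter U \<and> (\<forall>A\<in>S. \<forall>\<^sub>F i in U. i \<in> A)"
proof -
  define F where "F = (INF A\<in>S. principal A)"
  have "F \<noteq> bot"
  proof
    assume "F = bot"
    then have "eventually (\<lambda>_. False) F" by simp
    then obtain T where T: "finite T" "T \<subseteq> S" "eventually (\<lambda>_. False) (INF A\<in>T. principal A)"
      unfolding F_def by (auto dest: eventually_INF[THEN iffD1])
    then have "\<Inter>T = {}" by (auto simp: INF_principal_finite eventually_principal)
    with fip T show False by blast
  qed
  then obtain U where U: "U \<le> F" "ultrafilter U" by (rule ultrafilter_exists)
  have "\<forall>\<^sub>F i in U. i \<in> A" if "A \<in> S" for A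
  proof -
    have "F \<le> principal A" unfolding F_def using that by (rule INF_lower)
    then have "U \<le> principal A" using U(1) by order
    then show ?thesis by (simp add: le_principal)
  qed
  with U(2) show ?thesis by blast
qed

section \<open>Spectrality from ultrafilter limits\<close>

text \<open>\<open>ultra_limit\<close> and \<open>separating\<close> amount to saying that the patch
  topology, generated by the base sets and their complements, is compact Hausdorff. The guard on
  \<open>topspace T\<close> is there because \<open>F\<close> is a filter on the whole type.\<close>

locale spectral_base =
  fixes T :: "'x topology" and \<B> :: "'x set set"
  assumes base: "openin T = arbitrary union_of (\<lambda>U. U \<in> \<B>)"
    and Int_base: "\<lbrakk>U \<in> \<B>; V \<in> \<B>\<rbrakk> \<Longrightarrow> U \<inter> V \<in> \<B>"
    and separating: "\<lbrakk>x \<in> topspace T; y \<in> topspace T; x \<noteq> y\<rbrakk> \<Longrightarrow> \<exists>U\<in>\<B>. (x \<in> U) \<noteq> (y \<in> U)"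
    and ultra_limit: "\<lbrakk>ultrafilter F; \<forall>\<^sub>F x in F. x \<in> topspace T\<rbrakk> \<Longrightarrow>
      \<exists>x\<in>topspace T. \<forall>U\<in>\<B>. (\<forall>\<^sub>F y in F. y \<in> U) \<longleftrightarrow> x \<in> U"
begin

lemma base_open: "U \<in> \<B> \<Longrightarrow> openin T U"
  unfolding base by (metis arbitrary_union_of_inc)

lemma open_base_nbhd:
  assumes "openin T U" "x \<in> U"
  obtains V where "V \<in> \<B>" "x \<in> V" "V \<subseteq> U"
  using assms unfolding base union_of_def arbitrary_def by auto

text \<open>If an open cover of \<open>U\<close> had no finite subcover, some ultrafilter would
  contain \<open>U\<close> and the complement of every member of the cover, although its limit lies
  in \<open>U\<close> and hence in such a member. The hypothesis \<open>lim\<close> is closedness in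
  the patch topology; in this form the lemma serves both the base sets and the whole space, which
  need not be a base set.\<close>

lemma compactin_ultra_closed:
  assumes U: "U \<subseteq> topspace T"
    and lim: "\<And>F x. \<lbrakk>ultrafilter F; \<forall>\<^sub>F y in F. y \<in> U; x \<in> topspace T;
       \<And>V. V \<in> \<B> \<Longrightarrow> (\<forall>\<^sub>F y in F. y \<in> V) \<longleftrightarrow> x \<in> V\<rbrakk> \<Longrightarrow> x \<in> U"
  shows "compactin T U"
  unfolding compactin_def
proof (intro conjI allI impI U)
  fix \<C> assume C: "(\<forall>C\<in>\<C>. openin T C) \<and> U \<subseteq> \<Union>\<C>"
  show "\<exists>\<F>. finite \<F> \<and> \<F> \<subseteq> \<C> \<and> U \<subseteq> \<Union>\<F>"
  proof (rule ccontr)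
    assume neg: "\<nexists>\<F>. finite \<F> \<and> \<F> \<subseteq> \<C> \<and> U \<subseteq> \<Union>\<F>"
    have "\<Inter>\<T> \<noteq> {}" if T: "finite \<T>" "\<T> \<subseteq> insert U ((\<lambda>C. U - C) ` \<C>)" for \<T>
    proof -
      have "finite (\<T> - {U})" "\<T> - {U} \<subseteq> (\<lambda>C. U - C) ` \<C>" using T by auto
      then obtain \<F> where F: "finite \<F>" "\<F> \<subseteq> \<C>" "\<T> - {U} = (\<lambda>C. U - C) ` \<F>"
        by (meson finite_subset_image)
      have "\<not> U \<subseteq> \<Union>\<F>" using neg F(1,2) by meson
      then obtain x where "x \<in> U" "x \<notin> \<Union>\<F>" by blast
      have "x \<in> V" if "V \<in> \<T>" for V
      proof (cases "V = U")
        case False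
        then have "V \<in> (\<lambda>C. U - C) ` \<F>" using that unfolding F(3)[symmetric] by simp
        then show ?thesis using \<open>x \<in> U\<close> \<open>x \<notin> \<Union>\<F>\<close> by auto
      qed (use \<open>x \<in> U\<close> in simp)
      then show ?thesis by blast
    qed
    then have "\<exists>F. ultrafilter F \<and> (\<forall>A\<in>insert U ((\<lambda>C. U - C) ` \<C>). \<forall>\<^sub>F x in F. x \<in> A)"
      by (rule ultrafilter_of_family)
    then obtain F where F: "ultrafilter F" "\<And>A. A \<in> insert U ((\<lambda>C. U - C) ` \<C>) \<Longrightarrow> \<forall>\<^sub>F x in F. x \<in> A"
      by blast
    have FU: "\<forall>\<^sub>F x in F. x \<in> U" using F(2) by blast
    then have "\<forall>\<^sub>F x in F. x \<in> topspace T" by (rule eventually_mono) (use U in blast)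
    then obtain x where x: "x \<in> topspace T" "\<And>V. V \<in> \<B> \<Longrightarrow> (\<forall>\<^sub>F y in F. y \<in> V) \<longleftrightarrow> x \<in> V"
      using ultra_limit[OF F(1)] by blast
    have "x \<in> U" by (rule lim[OF F(1) FU x])
    then obtain D where D: "D \<in> \<C>" "x \<in> D" using C by blast
    then obtain V where V: "V \<in> \<B>" "x \<in> V" "V \<subseteq> D" using C open_base_nbhd by metis
    have "\<forall>\<^sub>F y in F. y \<in> V" using x(2) V by blast
    moreover have "\<forall>\<^sub>F y in F. y \<in> U - D" using F(2) D by blast
    ultimately have "\<forall>\<^sub>F y in F. False" by eventually_elim (use V in blast)
    then show False using ultrafilter.proper[OF F(1)] by simp
  qed
qed

lemma compactin_base: "U \<in> \<B> \<Longrightarrow> compactin T U"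
  by (rule compactin_ultra_closed) (use openin_subset[OF base_open] in auto)

lemma compact_open_Int:
  assumes U: "openin T U" "compactin T U" and V: "openin T V" "compactin T V"
  shows "compactin T (U \<inter> V)"
proof -
  have fin: "\<exists>\<F>. finite \<F> \<and> \<F> \<subseteq> \<B> \<and> W = \<Union>\<F>" if W: "openin T W" "compactin T W" for W
  proof -
    have "W \<subseteq> \<Union>{B\<in>\<B>. B \<subseteq> W}" using open_base_nbhd[OF W(1)] by blast
    moreover have "\<forall>B\<in>{B\<in>\<B>. B \<subseteq> W}. openin T B" using base_open by blast
    ultimately obtain \<F> where "finite \<F>" "\<F> \<subseteq> {B\<in>\<B>. B \<subseteq> W}" "W \<subseteq> \<Union>\<F>"
      using W(2) unfolding compactin_def by meson
    then show ?thesis by (intro exI[of _ \<F>]) auto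
  qed
  obtain \<F> \<G> where F: "finite \<F>" "\<F> \<subseteq> \<B>" "U = \<Union>\<F>" and G: "finite \<G>" "\<G> \<subseteq> \<B>" "V = \<Union>\<G>"
    using fin[OF U] fin[OF V] by blast
  have "U \<inter> V = \<Union>((\<lambda>(B, C). B \<inter> C) ` (\<F> \<times> \<G>))" using F(3) G(3) by blast
  moreover have "compactin T \<dots>"
    by (rule compactin_Union) (use F G in \<open>auto intro!: compactin_base Int_base\<close>)
  ultimately show ?thesis by simp
qed

text \<open>Irreducibility yields the finite intersection property for \<open>Z\<close> and the base
  sets that meet it. An ultrafilter containing all of these has its limit in every base set meeting
  \<open>Z\<close>, which puts \<open>Z\<close> into the closure of the limit; closedness of
  \<open>Z\<close> puts the limit into \<open>Z\<close>. Uniqueness is the T0 property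
  \<open>separating\<close>.\<close>

lemma irreducible_generic_point:
  assumes Z: "closedin T Z" "irreducible_in T Z"
  shows "\<exists>!x. x \<in> topspace T \<and> T closure_of {x} = Z"
proof -
  have ZT: "Z \<subseteq> topspace T" "Z \<noteq> {}"
    and irr: "\<And>C D. closedin T C \<Longrightarrow> closedin T D \<Longrightarrow> Z \<subseteq> C \<union> D \<Longrightarrow> Z \<subseteq> C \<or> Z \<subseteq> D"
    using Z(2) by (auto simp: irreducible_in_def)
  have meet: "Z \<inter> \<Inter>\<T> \<noteq> {}" if "finite \<T>" "\<T> \<subseteq> {U \<in> \<B>. Z \<inter> U \<noteq> {}}" for \<T>
  proof -
    \<comment> \<open>Openness is carried along in the induction, as irreducibility is applied to
      complements of open sets. \<open>\<Inter>{}\<close> is \<open>UNIV\<close>, hence the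
      intersection with \<open>topspace T\<close>.\<close>
    have "openin T (topspace T \<inter> \<Inter>\<T>) \<and> Z \<inter> \<Inter>\<T> \<noteq> {}"
      using that
    proof (induction \<T> rule: finite_induct)
      case empty
      then show ?case using ZT by simp
    next
      case (insert U \<T>)
      let ?I = "topspace T \<inter> \<Inter>\<T>"
      have I: "openin T ?I" "Z \<inter> \<Inter>\<T> \<noteq> {}" and U: "openin T U" "Z \<inter> U \<noteq> {}"
        using insert base_open by auto
      have "Z \<inter> (U \<inter> ?I) \<noteq> {}"
      proof
        assume "Z \<inter> (U \<inter> ?I) = {}"
        then have "Z \<subseteq> (topspace T - U) \<union> (topspace T - ?I)" using ZT by blast
        then have "Z \<subseteq> topspace T - U \<or> Z \<subseteq> topspace T - ?I"
          by (intro irr closedin_diff closedin_topspace U I)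
        then show False using U(2) I(2) ZT by blast
      qed
      moreover have "openin T (topspace T \<inter> \<Inter>(insert U \<T>))"
        using openin_Int[OF U(1) I(1)] by (simp add: Int_left_commute)
      ultimately show ?case by auto
    qed
    then show ?thesis ..
  qed
  have "\<Inter>\<T> \<noteq> {}" if "finite \<T>" "\<T> \<subseteq> insert Z {U \<in> \<B>. Z \<inter> U \<noteq> {}}" for \<T>
  proof -
    have "Z \<inter> \<Inter>(\<T> - {Z}) \<noteq> {}" using that by (intro meet) auto
    then show ?thesis by blast
  qed
  then have "\<exists>F. ultrafilter F \<and> (\<forall>A\<in>insert Z {U \<in> \<B>. Z \<inter> U \<noteq> {}}. \<forall>\<^sub>F x in F. x \<in> A)"
    by (rule ultrafilter_of_family)
  then obtain F where F: "ultrafilter F" "\<And>A. A \<in> insert Z {U \<in> \<B>. Z \<inter> U \<noteq> {}} \<Longrightarrow> \<forall>\<^sub>F x in F. x \<in> A"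
    by blast
  have FZ: "\<forall>\<^sub>F x in F. x \<in> Z" using F(2) by blast
  then have "\<forall>\<^sub>F x in F. x \<in> topspace T" by (rule eventually_mono) (use ZT in blast)
  then obtain x where x: "x \<in> topspace T" "\<And>V. V \<in> \<B> \<Longrightarrow> (\<forall>\<^sub>F y in F. y \<in> V) \<longleftrightarrow> x \<in> V"
    using ultra_limit[OF F(1)] by blast
  have "x \<in> Z"
  proof (rule ccontr)
    assume "x \<notin> Z"
    then obtain V where V: "V \<in> \<B>" "x \<in> V" "V \<subseteq> topspace T - Z"
      using open_base_nbhd[of "topspace T - Z" x] Z(1) x(1) by blast
    have "\<forall>\<^sub>F y in F. y \<in> V" using x(2) V by blast
    with FZ have "\<forall>\<^sub>F y in F. False" by eventually_elim (use V in blast)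
    then show False using ultrafilter.proper[OF F(1)] by simp
  qed
  have "T closure_of {x} = Z"
  proof
    show "T closure_of {x} \<subseteq> Z" using \<open>x \<in> Z\<close> Z(1) by (simp add: closure_of_minimal)
    show "Z \<subseteq> T closure_of {x}"
    proof
      fix y assume "y \<in> Z"
      have "x \<in> U" if U: "openin T U" "y \<in> U" for U
      proof -
        obtain V where "V \<in> \<B>" "y \<in> V" "V \<subseteq> U" using U by (rule open_base_nbhd)
        with \<open>y \<in> Z\<close> show ?thesis using F(2) x(2) by blast
      qed
      then show "y \<in> T closure_of {x}" using \<open>y \<in> Z\<close> ZT by (auto simp: in_closure_of)
    qed
  qed
  moreover have "y = x" if y: "y \<in> topspace T" "T closure_of {y} = Z" for y
  proof (rule ccontr)
    assume "y \<noteq> x"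
    then obtain U where U: "U \<in> \<B>" "(y \<in> U) \<noteq> (x \<in> U)" using separating y x(1) by blast
    have "x \<in> T closure_of {y}" "y \<in> T closure_of {x}"
      using \<open>T closure_of {x} = Z\<close> y closure_of_subset[of "{x}" T] closure_of_subset[of "{y}" T] x(1) by auto
    then show False using U base_open by (auto simp: in_closure_of)
  qed
  ultimately show ?thesis using x(1) by blast
qed

theorem spectral: "spectral_space T"
  unfolding spectral_space_def
proof (intro conjI allI impI)
  show "compact_space T"
    unfolding compact_space_def by (rule compactin_ultra_closed) auto
  show "openin T = arbitrary union_of (\<lambda>U. openin T U \<and> compactin T U)"
  proof
    fix U
    have "(arbitrary union_of (\<lambda>U. openin T U \<and> compactin T U)) U" if "openin T U"
    proof -
      have "U = \<Union>{V \<in> \<B>. V \<subseteq> U}" using open_base_nbhd[OF that] by blast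
      then show ?thesis unfolding union_of_def arbitrary_def
        using base_open compactin_base by (intro exI[of _ "{V \<in> \<B>. V \<subseteq> U}"]) auto
    qed
    then show "openin T U = (arbitrary union_of (\<lambda>U. openin T U \<and> compactin T U)) U"
      by (auto simp: union_of_def)
  qed
qed (use compact_open_Int irreducible_generic_point in auto)

end

section \<open>The calculus of domination\<close>

context value_group
begin

lemma ord_refl: "x \<in> carrier G \<Longrightarrow> (x, x) \<in> order_rel G"
  using linear_order by (auto simp: order_on_defs refl_on_def)

lemma ord_trans: "(x, y) \<in> order_rel G \<Longrightarrow> (y, z) \<in> order_rel G \<Longrightarrow> (x, z) \<in> order_rel G"
  using linear_order by (auto simp: order_on_defs dest: transD)

lemma ord_antisym: "(x, y) \<in> order_rel G \<Longrightarrow> (y, x) \<in> order_rel G \<Longrightarrow> x = y"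
  using linear_order by (auto simp: order_on_defs dest: antisymD)

lemma ord_total:
  "x \<in> carrier G \<Longrightarrow> y \<in> carrier G \<Longrightarrow> (x, y) \<in> order_rel G \<or> (y, x) \<in> order_rel G"
  using linear_order ord_refl by (cases "x = y") (auto simp: order_on_defs total_on_def)

lemma ord_mult_cancel:
  assumes "x \<in> carrier G" "y \<in> carrier G" "z \<in> carrier G"
  shows "(z \<otimes> x, z \<otimes> y) \<in> order_rel G \<longleftrightarrow> (x, y) \<in> order_rel G"
proof
  assume "(z \<otimes> x, z \<otimes> y) \<in> order_rel G"
  then have "(inv z \<otimes> (z \<otimes> x), inv z \<otimes> (z \<otimes> y)) \<in> order_rel G"
    using assms by (auto intro: mult_left_mono[where x = "z \<otimes> x" and y = "z \<otimes> y"])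
  moreover have "inv z \<otimes> (z \<otimes> t) = t" if "t \<in> carrier G" for t
    using assms(3) that by (simp add: m_assoc[symmetric])
  ultimately show "(x, y) \<in> order_rel G" using assms by simp
qed (use assms mult_left_mono in auto)

lemma ord_mult:
  assumes "(x, y) \<in> order_rel G" "(x', y') \<in> order_rel G"
    and "x \<in> carrier G" "y \<in> carrier G" "x' \<in> carrier G" "y' \<in> carrier G"
  shows "(x \<otimes> x', y \<otimes> y') \<in> order_rel G"
  using mult_left_mono[OF assms(2), of x] mult_left_mono[OF assms(1), of y'] assms(3-)
  by (auto simp: m_comm intro: ord_trans)

end

lemma (in reified_value_group) reify_inverse:
  assumes "0 < q" "x \<in> carrier G"
  shows "reify G (1 / q) \<otimes> (reify G q \<otimes> x) = x" "reify G q \<otimes> (reify G (1 / q) \<otimes> x) = x"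
  using assms by (simp_all add: m_assoc[symmetric] reify_closed reify_mult[symmetric] reify_one)

locale rsv = A: cring A + G: reified_value_group G
  for A :: "('a, 'k) ring_scheme" and G :: "'g reified_monoid" +
  fixes v :: "'a \<Rightarrow> 'g option"
  assumes semival: "semivaluation A G v"

lemma rsv_iff: "cring A \<Longrightarrow> rsv A G v \<longleftrightarrow> reified_semivaluation A G v"
  by (auto simp: rsv_def rsv_axioms_def reified_semivaluation_def)

context rsv
begin

abbreviation D :: "'a \<Rightarrow> real \<Rightarrow> 'a \<Rightarrow> bool" where
  "D \<equiv> dominated G v"

abbreviation val :: "'a \<Rightarrow> 'g" where
  "val a \<equiv> the (v a)"

lemma reified: "reified_semivaluation A G v"
  using semival G.reified_value_group_axioms by (simp add: reified_semivaluation_def)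

lemma val_closed [simp]: "a \<in> carrier A \<Longrightarrow> v a \<noteq> None \<Longrightarrow> val a \<in> carrier G"
  using rsv_value_closed[OF reified] by auto

lemma v_zero [simp]: "v \<zero>\<^bsub>A\<^esub> = None" and v_one [simp]: "v \<one>\<^bsub>A\<^esub> = Some \<one>\<^bsub>G\<^esub>"
  using semival by (auto simp: semivaluation_def)

lemma one_neq_zero: "\<one>\<^bsub>A\<^esub> \<noteq> \<zero>\<^bsub>A\<^esub>"
  using v_zero v_one by (metis option.distinct(1))

lemma v_mult:
  assumes "a \<in> carrier A" "b \<in> carrier A"
  shows v_mult_None: "v (a \<otimes>\<^bsub>A\<^esub> b) = None \<longleftrightarrow> v a = None \<or> v b = None"
    and val_mult: "v a \<noteq> None \<Longrightarrow> v b \<noteq> None \<Longrightarrow> val (a \<otimes>\<^bsub>A\<^esub> b) = val a \<otimes>\<^bsub>G\<^esub> val b"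
  using semival assms by (cases "v a"; cases "v b"; auto simp: semivaluation_def)+

lemma v_add:
  "a \<in> carrier A \<Longrightarrow> b \<in> carrier A \<Longrightarrow> le0 G (v (a \<oplus>\<^bsub>A\<^esub> b)) (v a) \<or> le0 G (v (a \<oplus>\<^bsub>A\<^esub> b)) (v b)"
  using semival by (auto simp: semivaluation_def max0_def split: if_splits)

lemma dominated_iff:
  "D a q b \<longleftrightarrow> v b \<noteq> None \<and> (v a \<noteq> None \<longrightarrow> (val a, reify G q \<otimes>\<^bsub>G\<^esub> val b) \<in> order_rel G)"
  by (cases "v a"; cases "v b") (auto simp: dominated_def)

text \<open>Nonvanishing can be read off from domination: wherever only the relation
  \<open>D\<close> is at hand, \<open>D b 1 b\<close> stands for v(b) \<noteq> 0.\<close>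

lemma dominated_refl_iff: "b \<in> carrier A \<Longrightarrow> D b 1 b \<longleftrightarrow> v b \<noteq> None"
  by (auto simp: dominated_iff G.reify_one intro!: G.ord_refl val_closed simp del: not_None_eq)

lemma dominated_nonzero: "D a q b \<Longrightarrow> v b \<noteq> None"
  by (simp add: dominated_iff)

lemma dominated_trans:
  assumes "D a p b" "D b q c" and [simp]: "a \<in> carrier A" "b \<in> carrier A" "c \<in> carrier A" "0 < p" "0 < q"
  shows "D a (p * q) c"
proof (cases "v a = None")
  case False
  then have *: "v b \<noteq> None" "v c \<noteq> None" "(val a, reify G p \<otimes>\<^bsub>G\<^esub> val b) \<in> order_rel G"
    "(val b, reify G q \<otimes>\<^bsub>G\<^esub> val c) \<in> order_rel G"
    using assms by (auto simp: dominated_iff)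
  then have "(reify G p \<otimes>\<^bsub>G\<^esub> val b, reify G p \<otimes>\<^bsub>G\<^esub> (reify G q \<otimes>\<^bsub>G\<^esub> val c)) \<in> order_rel G"
    by (intro G.mult_left_mono) (auto simp: G.reify_closed)
  with * show ?thesis
    by (auto simp: dominated_iff G.reify_mult G.m_assoc G.reify_closed intro: G.ord_trans)
qed (use assms in \<open>auto simp: dominated_iff\<close>)

lemma dominated_mono:
  assumes "D a p b" "p \<le> q" "0 < p" "a \<in> carrier A" "b \<in> carrier A"
  shows "D a q b"
proof (cases "v a = None")
  case False
  then have *: "v b \<noteq> None" "(val a, reify G p \<otimes>\<^bsub>G\<^esub> val b) \<in> order_rel G"
    using assms by (auto simp: dominated_iff)
  have "(reify G p \<otimes>\<^bsub>G\<^esub> val b, reify G q \<otimes>\<^bsub>G\<^esub> val b) \<in> order_rel G"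
    using assms * by (intro G.ord_mult G.reify_mono G.ord_refl) (auto simp: G.reify_closed)
  with * show ?thesis by (auto simp: dominated_iff intro: G.ord_trans)
qed (use assms in \<open>auto simp: dominated_iff\<close>)

lemma dominated_mult:
  assumes "D a p b" "D c q d"
    and [simp]: "a \<in> carrier A" "b \<in> carrier A" "c \<in> carrier A" "d \<in> carrier A" "0 < p" "0 < q"
  shows "D (a \<otimes>\<^bsub>A\<^esub> c) (p * q) (b \<otimes>\<^bsub>A\<^esub> d)"
proof (cases "v a = None \<or> v c = None")
  case False
  have "v b \<noteq> None" "v d \<noteq> None" using assms by (auto simp: dominated_iff)
  moreover have "(val a \<otimes>\<^bsub>G\<^esub> val c, (reify G p \<otimes>\<^bsub>G\<^esub> val b) \<otimes>\<^bsub>G\<^esub> (reify G q \<otimes>\<^bsub>G\<^esub> val d)) \<in> order_rel G"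
    using assms False by (intro G.ord_mult) (auto simp: dominated_iff G.reify_closed)
  ultimately show ?thesis using False
    by (simp add: dominated_iff v_mult G.reify_mult G.reify_closed G.m_ac)
qed (use assms in \<open>auto simp: dominated_iff v_mult_None\<close>)

text \<open>The conjunct \<open>v c \<noteq> None\<close> comes from the clause in domination that
  the right-hand element, here a product, be nonzero. Cancellation is what splits a condition on
  products into its factors in \<open>rational_Int\<close>.\<close>

lemma dominated_cancel:
  assumes [simp]: "a \<in> carrier A" "b \<in> carrier A" "c \<in> carrier A" "0 < q"
  shows "D (a \<otimes>\<^bsub>A\<^esub> c) q (b \<otimes>\<^bsub>A\<^esub> c) \<longleftrightarrow> v c \<noteq> None \<and> D a q b"
proof (cases "v a = None \<or> v b = None \<or> v c = None")
  case False
  have "(val a \<otimes>\<^bsub>G\<^esub> val c, reify G q \<otimes>\<^bsub>G\<^esub> (val b \<otimes>\<^bsub>G\<^esub> val c)) \<in> order_rel G \<longleftrightarrow>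
      (val c \<otimes>\<^bsub>G\<^esub> val a, val c \<otimes>\<^bsub>G\<^esub> (reify G q \<otimes>\<^bsub>G\<^esub> val b)) \<in> order_rel G"
    using False by (simp add: G.m_ac G.reify_closed)
  also have "\<dots> \<longleftrightarrow> (val a, reify G q \<otimes>\<^bsub>G\<^esub> val b) \<in> order_rel G"
    using False by (intro G.ord_mult_cancel) (auto simp: G.reify_closed)
  finally show ?thesis using False by (simp add: dominated_iff v_mult)
qed (auto simp: dominated_iff v_mult_None)

lemma dominated_add:
  assumes "D a q b" "D c q b" "a \<in> carrier A" "b \<in> carrier A" "c \<in> carrier A" "0 < q"
  shows "D (a \<oplus>\<^bsub>A\<^esub> c) q b"
proof -
  have "D s q b" if "le0 G (v s) (v t)" "D t q b" for s t
    using that by (cases "v s"; cases "v t") (auto simp: dominated_iff intro: G.ord_trans)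
  then show ?thesis using v_add[of a c] assms by blast
qed

text \<open>If both values vanish, neither disjunct holds, since domination requires a nonzero
  right-hand element; this is what \<open>v b \<noteq> None\<close> rules out.\<close>

lemma dominated_total:
  assumes [simp]: "a \<in> carrier A" "b \<in> carrier A" "0 < q" and b: "v b \<noteq> None"
  shows "D a q b \<or> D b (1 / q) a"
proof (cases "v a = None")
  case False
  have "(val a, reify G q \<otimes>\<^bsub>G\<^esub> val b) \<in> order_rel G \<or> (reify G q \<otimes>\<^bsub>G\<^esub> val b, val a) \<in> order_rel G"
    using b False by (intro G.ord_total) (auto simp: G.reify_closed)
  moreover have "(val b, reify G (1 / q) \<otimes>\<^bsub>G\<^esub> val a) \<in> order_rel G"
    if "(reify G q \<otimes>\<^bsub>G\<^esub> val b, val a) \<in> order_rel G"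
  proof -
    have "(reify G (1 / q) \<otimes>\<^bsub>G\<^esub> (reify G q \<otimes>\<^bsub>G\<^esub> val b), reify G (1 / q) \<otimes>\<^bsub>G\<^esub> val a) \<in> order_rel G"
      using that by (intro G.mult_left_mono) (auto simp: G.reify_closed)
    then show ?thesis using b by (simp add: G.reify_inverse)
  qed
  ultimately show ?thesis using b False by (auto simp: dominated_iff)
qed (use b in \<open>auto simp: dominated_iff\<close>)

section \<open>The value subgroup as a group of fractions\<close>

text \<open>The triples do not refer to \<open>v\<close>, so the fractions of two semivaluations on
  \<open>A\<close> can be matched triple by triple even though their groups are unrelated.\<close>

definition fraction :: "real \<times> 'a \<times> 'a \<Rightarrow> 'g" where
  "fraction = (\<lambda>(q, a, b). reify G q \<otimes>\<^bsub>G\<^esub> (val a \<otimes>\<^bsub>G\<^esub> inv\<^bsub>G\<^esub> val b))"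

definition fractions :: "(real \<times> 'a \<times> 'a) set" where
  "fractions = {(q, a, b). 0 < q \<and> a \<in> carrier A \<and> b \<in> carrier A \<and> v a \<noteq> None \<and> v b \<noteq> None}"

lemma fraction_closed: "s \<in> fractions \<Longrightarrow> fraction s \<in> carrier G"
  by (cases s) (simp add: fractions_def fraction_def G.reify_closed del: not_None_eq)

text \<open>Cross-multiplication: p v(a) / v(b) \<le> q v(c) / v(d) means v(a d) \<le> (q / p) v(c
  b). Thus domination determines the order on the value subgroup and, through antisymmetry, the
  equality of fractions.\<close>

lemma fraction_le_iff:
  assumes "(p, a, b) \<in> fractions" "(q, c, d) \<in> fractions"
  shows "(fraction (p, a, b), fraction (q, c, d)) \<in> order_rel G \<longleftrightarrow>
    D (a \<otimes>\<^bsub>A\<^esub> d) (q / p) (c \<otimes>\<^bsub>A\<^esub> b)"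
proof -
  \<comment> \<open>Multiplying by v(b) v(d) / p clears the denominators and moves the constant
    \<open>p\<close> to the right-hand side.\<close>
  let ?z = "reify G (1 / p) \<otimes>\<^bsub>G\<^esub> (val b \<otimes>\<^bsub>G\<^esub> val d)"
  have [simp]: "0 < p" "0 < q" "p \<noteq> 0" "a \<in> carrier A" "b \<in> carrier A" "c \<in> carrier A" "d \<in> carrier A"
    and nz: "v a \<noteq> None" "v b \<noteq> None" "v c \<noteq> None" "v d \<noteq> None"
    using assms by (auto simp: fractions_def)
  have cl [simp]: "reify G p \<in> carrier G" "reify G q \<in> carrier G" "reify G (1 / p) \<in> carrier G"
    "reify G (q / p) \<in> carrier G" by (simp_all add: G.reify_closed)
  have vc [simp]: "val a \<in> carrier G" "val b \<in> carrier G" "val c \<in> carrier G" "val d \<in> carrier G"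
    using nz by simp_all
  have "?z \<otimes>\<^bsub>G\<^esub> fraction (p, a, b) =
      (reify G (1 / p) \<otimes>\<^bsub>G\<^esub> reify G p) \<otimes>\<^bsub>G\<^esub> ((val b \<otimes>\<^bsub>G\<^esub> inv\<^bsub>G\<^esub> val b) \<otimes>\<^bsub>G\<^esub> (val a \<otimes>\<^bsub>G\<^esub> val d))"
    unfolding fraction_def by (simp only: split vc cl G.m_ac G.m_closed G.inv_closed)
  also have "\<dots> = val a \<otimes>\<^bsub>G\<^esub> val d"
    by (simp add: G.reify_mult[symmetric] G.reify_one)
  finally have 1: "?z \<otimes>\<^bsub>G\<^esub> fraction (p, a, b) = val a \<otimes>\<^bsub>G\<^esub> val d" .
  have "?z \<otimes>\<^bsub>G\<^esub> fraction (q, c, d) =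
      (reify G (1 / p) \<otimes>\<^bsub>G\<^esub> reify G q) \<otimes>\<^bsub>G\<^esub> ((val d \<otimes>\<^bsub>G\<^esub> inv\<^bsub>G\<^esub> val d) \<otimes>\<^bsub>G\<^esub> (val c \<otimes>\<^bsub>G\<^esub> val b))"
    unfolding fraction_def by (simp only: split vc cl G.m_ac G.m_closed G.inv_closed)
  also have "\<dots> = reify G (q / p) \<otimes>\<^bsub>G\<^esub> (val c \<otimes>\<^bsub>G\<^esub> val b)"
    by (simp add: G.reify_mult[symmetric])
  finally have 2: "?z \<otimes>\<^bsub>G\<^esub> fraction (q, c, d) = reify G (q / p) \<otimes>\<^bsub>G\<^esub> (val c \<otimes>\<^bsub>G\<^esub> val b)" .
  have "(fraction (p, a, b), fraction (q, c, d)) \<in> order_rel G \<longleftrightarrow>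
      (?z \<otimes>\<^bsub>G\<^esub> fraction (p, a, b), ?z \<otimes>\<^bsub>G\<^esub> fraction (q, c, d)) \<in> order_rel G"
    by (rule G.ord_mult_cancel[symmetric]) (auto simp: fraction_def)
  then show ?thesis unfolding 1 2 using nz by (simp add: dominated_iff v_mult)
qed

lemma fraction_reify: "0 < q \<Longrightarrow> fraction (q, \<one>\<^bsub>A\<^esub>, \<one>\<^bsub>A\<^esub>) = reify G q"
  by (simp add: fraction_def G.reify_closed)

lemma fraction_val: "a \<in> carrier A \<Longrightarrow> v a \<noteq> None \<Longrightarrow> fraction (1, a, \<one>\<^bsub>A\<^esub>) = val a"
  by (simp add: fraction_def G.reify_one)

lemma fraction_mult:
  assumes "(p, a, b) \<in> fractions" "(q, c, d) \<in> fractions"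
  shows "(p * q, a \<otimes>\<^bsub>A\<^esub> c, b \<otimes>\<^bsub>A\<^esub> d) \<in> fractions"
    and "fraction (p * q, a \<otimes>\<^bsub>A\<^esub> c, b \<otimes>\<^bsub>A\<^esub> d) = fraction (p, a, b) \<otimes>\<^bsub>G\<^esub> fraction (q, c, d)"
  using assms
  by (auto simp: fractions_def fraction_def v_mult G.reify_mult G.reify_closed G.inv_mult G.m_ac simp del: not_None_eq)

lemma value_subgroup_eq: "value_subgroup A G v = fraction ` fractions"
proof
  show "value_subgroup A G v \<subseteq> fraction ` fractions"
  proof
    fix x assume "x \<in> value_subgroup A G v"
    from value_subgroup_fraction[OF A.cring_axioms reified this] obtain q a b g h
      where "0 < q" "a \<in> carrier A" "b \<in> carrier A" "v a = Some g" "v b = Some h"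
        "x = reify G q \<otimes>\<^bsub>G\<^esub> (g \<otimes>\<^bsub>G\<^esub> inv\<^bsub>G\<^esub> h)" by blast
    then have "x = fraction (q, a, b)" "(q, a, b) \<in> fractions" by (auto simp: fraction_def fractions_def)
    then show "x \<in> fraction ` fractions" by blast
  qed
  have gen: "reify G q \<in> value_subgroup A G v" if "0 < q" for q
    unfolding value_subgroup_def by (rule generate.incl) (use that in auto)
  have gen': "val a \<in> value_subgroup A G v" if "a \<in> carrier A" "v a \<noteq> None" for a
    unfolding value_subgroup_def by (rule generate.incl) (use that in auto)
  note sub = value_subgroup_is_subgroup[OF reified]
  show "fraction ` fractions \<subseteq> value_subgroup A G v"
    by (auto simp: fractions_def fraction_def simp del: not_None_eq
        intro!: subgroup.m_closed[OF sub] subgroup.m_inv_closed[OF sub] gen gen')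
qed

text \<open>Commensurability speaks of quotients v(a) / v(b). The upper bound on v(b) from
  \<open>bounded\<close> reduces it to lower bounds on the numerators, a statement in terms of
  domination alone.\<close>

lemma coinitial_iff:
  assumes bounded: "\<And>a. a \<in> carrier A \<Longrightarrow> \<exists>s>0. D a s \<one>\<^bsub>A\<^esub>"
  shows "(\<forall>\<gamma>\<in>value_subgroup A G v. \<exists>r>0. (reify G r, \<gamma>) \<in> order_rel G) \<longleftrightarrow>
    (\<forall>a\<in>carrier A. D a 1 a \<longrightarrow> (\<exists>r>0. D \<one>\<^bsub>A\<^esub> r a))"
proof -
  have le: "(reify G r, fraction (q, a, b)) \<in> order_rel G \<longleftrightarrow> D b (q / r) a"
    if "0 < r" "(q, a, b) \<in> fractions" for r q a b
    using fraction_le_iff[of r "\<one>\<^bsub>A\<^esub>" "\<one>\<^bsub>A\<^esub>" q a b] that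
    by (auto simp: fraction_reify) (auto simp: fractions_def)
  show ?thesis
  proof (intro iffI ballI impI)
    fix a assume *: "\<forall>\<gamma>\<in>value_subgroup A G v. \<exists>r>0. (reify G r, \<gamma>) \<in> order_rel G"
      and a: "a \<in> carrier A" "D a 1 a"
    then have fr: "(1, a, \<one>\<^bsub>A\<^esub>) \<in> fractions" by (auto simp: fractions_def dominated_iff)
    then obtain r where "0 < r" "(reify G r, fraction (1, a, \<one>\<^bsub>A\<^esub>)) \<in> order_rel G"
      using * value_subgroup_eq by blast
    then show "\<exists>r>0. D \<one>\<^bsub>A\<^esub> r a" using le fr by (intro exI[of _ "1 / r"]) auto
  next
    fix \<gamma> assume *: "\<forall>a\<in>carrier A. D a 1 a \<longrightarrow> (\<exists>r>0. D \<one>\<^bsub>A\<^esub> r a)" and "\<gamma> \<in> value_subgroup A G v"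
    then obtain q a b where g: "\<gamma> = fraction (q, a, b)" "(q, a, b) \<in> fractions"
      by (auto simp: value_subgroup_eq)
    then have [simp]: "0 < q" "q \<noteq> 0" "a \<in> carrier A" "b \<in> carrier A" "v a \<noteq> None" by (auto simp: fractions_def)
    obtain r s where rs: "0 < r" "D \<one>\<^bsub>A\<^esub> r a" "0 < s" "D b s \<one>\<^bsub>A\<^esub>"
      using * bounded[of b] dominated_refl_iff[of a] by auto
    \<comment> \<open>From v(b) \<le> s and 1 \<le> r v(a) follows v(b) \<le> s r v(a), so the
      fraction q v(a) / v(b) is at least q / (s r).\<close>
    have "D b (s * r) a" by (rule dominated_trans[OF rs(4,2)]) (use rs in auto)
    then have "(reify G (q / (s * r)), \<gamma>) \<in> order_rel G"
      unfolding g(1) using le[OF _ g(2), of "q / (s * r)"] rs by simp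
    then show "\<exists>r>0. (reify G r, \<gamma>) \<in> order_rel G"
      using rs by (intro exI[of _ "q / (s * r)"]) auto
  qed
qed

end

section \<open>Equivalence of semivaluations in terms of domination\<close>

lemma dominated_equivalent_imp:
  assumes A: "cring A" and v: "reified_semivaluation A G v" and w: "reified_semivaluation A H w"
    and eq: "rsv_equivalent A G v H w" and ab: "a \<in> carrier A" "b \<in> carrier A" "0 < q"
    and dom: "dominated G v a q b"
  shows "dominated H w a q b"
proof -
  interpret V: rsv A G v using v A by (simp add: rsv_iff)
  interpret W: rsv A H w using w A by (simp add: rsv_iff)
  let ?S = "value_subgroup A G v"
  obtain \<phi> where \<phi>: "\<phi> \<in> iso (G\<lparr>carrier := ?S\<rparr>) (H\<lparr>carrier := value_subgroup A H w\<rparr>)"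
    and ord: "\<And>x y. x \<in> ?S \<Longrightarrow> y \<in> ?S \<Longrightarrow> (x, y) \<in> order_rel G \<Longrightarrow> (\<phi> x, \<phi> y) \<in> order_rel H"
    and reify: "\<And>q. 0 < q \<Longrightarrow> \<phi> (reify G q) = reify H q"
    and val: "\<And>a. a \<in> carrier A \<Longrightarrow> map_option \<phi> (v a) = w a"
    using eq unfolding rsv_equivalent_def by blast
  have rS: "reify G q \<in> ?S"
    unfolding value_subgroup_def by (rule generate.incl) (use ab in auto)
  have vS: "V.val c \<in> ?S" if "c \<in> carrier A" "v c \<noteq> None" for c
    unfolding value_subgroup_def by (rule generate.incl) (use that in auto)
  have nz: "w c \<noteq> None \<longleftrightarrow> v c \<noteq> None" "v c \<noteq> None \<Longrightarrow> W.val c = \<phi> (V.val c)" if "c \<in> carrier A" for c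
    unfolding val[OF that, symmetric] by (auto simp: option.map_sel)
  show ?thesis
  proof (cases "v a = None")
    case True
    then show ?thesis using dom ab nz by (simp add: W.dominated_iff V.dominated_iff)
  next
    case False
    have b: "v b \<noteq> None" and le: "(V.val a, reify G q \<otimes>\<^bsub>G\<^esub> V.val b) \<in> order_rel G"
      using dom False by (auto simp: V.dominated_iff)
    have "reify G q \<otimes>\<^bsub>G\<^esub> V.val b \<in> ?S"
      by (rule subgroup.m_closed[OF value_subgroup_is_subgroup[OF v] rS vS[OF ab(2) b]])
    then have "(\<phi> (V.val a), \<phi> (reify G q \<otimes>\<^bsub>G\<^esub> V.val b)) \<in> order_rel H"
      by (intro ord le vS ab False)
    also have "\<phi> (reify G q \<otimes>\<^bsub>G\<^esub> V.val b) = reify H q \<otimes>\<^bsub>H\<^esub> \<phi> (V.val b)"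
      using \<phi> rS vS[OF ab(2) b] ab by (auto simp: iso_def hom_def reify)
    finally show ?thesis using False b ab nz by (auto simp: W.dominated_iff)
  qed
qed

lemma dominated_equivalent:
  assumes "cring A" "reified_semivaluation A G v" "reified_semivaluation A H w" "rsv_equivalent A G v H w"
    and "a \<in> carrier A" "b \<in> carrier A" "0 < q"
  shows "dominated G v a q b \<longleftrightarrow> dominated H w a q b"
  using dominated_equivalent_imp[OF assms(1-7)]
    dominated_equivalent_imp[OF assms(1,3,2) rsv_equivalent_sym[OF assms(2-4)] assms(5-7)] by blast

text \<open>Both semivaluations admit the same triples as fractions and order them alike, so sending
  the fraction of a triple for \<open>v\<close> to the fraction of the same triple for
  \<open>w\<close> is a well-defined order isomorphism of the value subgroups.\<close>

lemma equivalent_if_dominated_eq: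
  assumes A: "cring A" and v: "reified_semivaluation A G v" and w: "reified_semivaluation A H w"
    and eq: "\<And>a q b. \<lbrakk>a \<in> carrier A; b \<in> carrier A; 0 < q\<rbrakk> \<Longrightarrow> dominated G v a q b \<longleftrightarrow> dominated H w a q b"
  shows "rsv_equivalent A G v H w"
proof -
  interpret V: rsv A G v using v A by (simp add: rsv_iff)
  interpret W: rsv A H w using w A by (simp add: rsv_iff)
  have nz: "v a \<noteq> None \<longleftrightarrow> w a \<noteq> None" if "a \<in> carrier A" for a
    using eq[OF that that zero_less_one] V.dominated_refl_iff W.dominated_refl_iff that by blast
  then have fr: "W.fractions = V.fractions"
    unfolding W.fractions_def V.fractions_def by blast
  have le: "(V.fraction s, V.fraction t) \<in> order_rel G \<longleftrightarrow> (W.fraction s, W.fraction t) \<in> order_rel H"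
    if s: "s \<in> V.fractions" and t: "t \<in> V.fractions" for s t
  proof -
    obtain p a b q c d where [simp]: "s = (p, a, b)" "t = (q, c, d)" by (cases s, cases t)
    have "V.D (a \<otimes>\<^bsub>A\<^esub> d) (q / p) (c \<otimes>\<^bsub>A\<^esub> b) \<longleftrightarrow> W.D (a \<otimes>\<^bsub>A\<^esub> d) (q / p) (c \<otimes>\<^bsub>A\<^esub> b)"
      using s t by (intro eq) (auto simp: V.fractions_def)
    then show ?thesis using s t by (simp add: fr V.fraction_le_iff W.fraction_le_iff)
  qed
  have eqf: "V.fraction s = V.fraction t \<longleftrightarrow> W.fraction s = W.fraction t"
    if "s \<in> V.fractions" "t \<in> V.fractions" for s t
    using le[OF that] le[OF that(2,1)] V.G.ord_antisym W.G.ord_antisym V.G.ord_refl W.G.ord_refl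
      V.fraction_closed W.fraction_closed that fr
    by metis
  define \<phi> where "\<phi> = (\<lambda>x. W.fraction (inv_into V.fractions V.fraction x))"
  have \<phi>: "\<phi> (V.fraction s) = W.fraction s" if "s \<in> V.fractions" for s
    unfolding \<phi>_def using eqf that by (metis f_inv_into_f image_eqI inv_into_into)
  have SV: "value_subgroup A G v = V.fraction ` V.fractions" by (rule V.value_subgroup_eq)
  have SW: "value_subgroup A H w = W.fraction ` V.fractions" using W.value_subgroup_eq fr by simp
  have mult: "\<phi> (x \<otimes>\<^bsub>G\<^esub> y) = \<phi> x \<otimes>\<^bsub>H\<^esub> \<phi> y"
    if x: "x \<in> value_subgroup A G v" and y: "y \<in> value_subgroup A G v" for x y
  proof -
    obtain p a b q c d where s: "(p, a, b) \<in> V.fractions" "x = V.fraction (p, a, b)"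
      and t: "(q, c, d) \<in> V.fractions" "y = V.fraction (q, c, d)"
      using x y unfolding SV by auto
    have "x \<otimes>\<^bsub>G\<^esub> y = V.fraction (p * q, a \<otimes>\<^bsub>A\<^esub> c, b \<otimes>\<^bsub>A\<^esub> d)"
      using s t by (simp add: V.fraction_mult)
    then show ?thesis
      using s t W.fraction_mult(2)[of p a b q c d] V.fraction_mult(1)[of p a b q c d] by (simp add: \<phi> fr)
  qed
  have bij: "bij_betw \<phi> (value_subgroup A G v) (value_subgroup A H w)"
    unfolding bij_betw_def SV SW by (auto simp: inj_on_def \<phi> eqf image_image)
  have "\<phi> \<in> iso (G\<lparr>carrier := value_subgroup A G v\<rparr>) (H\<lparr>carrier := value_subgroup A H w\<rparr>)"
    using bij mult by (auto simp: iso_def hom_def bij_betw_def)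
  moreover have "\<phi> (reify G q) = reify H q" if "0 < q" for q
    using \<phi>[of "(q, \<one>\<^bsub>A\<^esub>, \<one>\<^bsub>A\<^esub>)"] that
    by (simp add: V.fraction_reify W.fraction_reify V.fractions_def)
  moreover have "map_option \<phi> (v a) = w a" if "a \<in> carrier A" for a
  proof (cases "v a")
    case None
    then show ?thesis using nz[OF that] by simp
  next
    case (Some g)
    then have "\<phi> g = W.val a"
      using \<phi>[of "(1, a, \<one>\<^bsub>A\<^esub>)"] that nz[OF that]
      by (simp add: V.fraction_val W.fraction_val V.fractions_def)
    then show ?thesis using Some nz[OF that] by auto
  qed
  moreover have "(\<phi> x, \<phi> y) \<in> order_rel H"
    if "x \<in> value_subgroup A G v" "y \<in> value_subgroup A G v" "(x, y) \<in> order_rel G" for x y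
    using that le unfolding SV by (auto simp: \<phi>)
  ultimately show ?thesis unfolding rsv_equivalent_def by blast
qed

section \<open>Ultraproducts of reified semivaluations\<close>

lemma (in value_group) le0_max0I:
  assumes "le0 G z x \<or> le0 G z y" "x \<in> insert None (Some ` carrier G)" "y \<in> insert None (Some ` carrier G)"
  shows "le0 G z (max0 G x y)"
proof -
  have trans: "le0 G r t" if "le0 G r s" "le0 G s t" for r s t
    using that by (cases r; cases s; cases t) (auto intro: ord_trans)
  have "le0 G x y \<or> le0 G y x"
    using assms(2,3) ord_total by (cases x; cases y) auto
  then show ?thesis
    using assms(1) trans[of z x y] trans[of z y x] by (auto simp: max0_def)
qed

text \<open>Elements of the ultraproduct are functions, normalised by choosing one function from each class
  of almost everywhere equal functions.\<close>

definition ultra_nf :: "'i filter \<Rightarrow> ('i \<Rightarrow> 'g) \<Rightarrow> ('i \<Rightarrow> 'g)" where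
  "ultra_nf F f = (SOME g. \<forall>\<^sub>F i in F. g i = f i)"

lemma eventually_ultra_nf: "\<forall>\<^sub>F i in F. ultra_nf F f i = f i"
  unfolding ultra_nf_def by (rule someI[of _ f]) simp

text \<open>Almost everywhere equal functions satisfy the same condition under \<open>SOME\<close>,
  so the same function is chosen, and equality in the ultraproduct becomes genuine equality.\<close>

lemma ultra_nf_cong:
  assumes "\<forall>\<^sub>F i in F. f i = g i"
  shows "ultra_nf F f = ultra_nf F g"
proof -
  have "(\<forall>\<^sub>F i in F. h i = f i) \<longleftrightarrow> (\<forall>\<^sub>F i in F. h i = g i)" for h :: "'a \<Rightarrow> 'b"
    by (rule eventually_cong[OF assms]) simp
  then show ?thesis unfolding ultra_nf_def by simp
qed

definition ultra_group :: "'i filter \<Rightarrow> ('i \<Rightarrow> 'g reified_monoid) \<Rightarrow> ('i \<Rightarrow> 'g) reified_monoid" where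
  "ultra_group F G =
    \<lparr>carrier = {f. ultra_nf F f = f \<and> (\<forall>\<^sub>F i in F. f i \<in> carrier (G i))},
     monoid.mult = (\<lambda>f g. ultra_nf F (\<lambda>i. f i \<otimes>\<^bsub>G i\<^esub> g i)),
     one = ultra_nf F (\<lambda>i. \<one>\<^bsub>G i\<^esub>),
     order_rel = {(f, g). ultra_nf F f = f \<and> ultra_nf F g = g \<and>
       (\<forall>\<^sub>F i in F. f i \<in> carrier (G i) \<and> g i \<in> carrier (G i) \<and> (f i, g i) \<in> order_rel (G i))},
     reify = (\<lambda>q. ultra_nf F (\<lambda>i. reify (G i) q))\<rparr>"

text \<open>Only almost all \<open>G i\<close> are assumed to be reified value groups, because the
  index will range over a whole type, while \<open>F\<close> is merely concentrated on the points of
  the spectrum.\<close>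

locale ultra_reified = ultrafilter F
  for F :: "'i filter" +
  fixes G :: "'i \<Rightarrow> 'g reified_monoid"
  assumes eventually_reified: "\<forall>\<^sub>F i in F. reified_value_group (G i)"
begin

abbreviation "nf \<equiv> ultra_nf F"

abbreviation "U \<equiv> ultra_group F G"

lemma nf_mem:
  assumes "\<forall>\<^sub>F i in F. f i \<in> carrier (G i)"
  shows "nf f \<in> carrier U"
proof -
  have "\<forall>\<^sub>F i in F. nf f i \<in> carrier (G i)"
    using assms eventually_ultra_nf[of F f] by eventually_elim simp
  moreover have "nf (nf f) = nf f" by (rule ultra_nf_cong[OF eventually_ultra_nf])
  ultimately show ?thesis by (simp add: ultra_group_def)
qed

lemma carrierD: "f \<in> carrier U \<Longrightarrow> \<forall>\<^sub>F i in F. f i \<in> carrier (G i)"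
  and nf_carrier: "f \<in> carrier U \<Longrightarrow> nf f = f"
  by (simp_all add: ultra_group_def)

lemma nf_eqI: "g \<in> carrier U \<Longrightarrow> \<forall>\<^sub>F i in F. f i = g i \<Longrightarrow> nf f = g"
  using ultra_nf_cong[of f g F] nf_carrier[of g] by simp

lemma order_iff:
  "(f, g) \<in> order_rel U \<longleftrightarrow> f \<in> carrier U \<and> g \<in> carrier U \<and> (\<forall>\<^sub>F i in F. (f i, g i) \<in> order_rel (G i))"
  by (auto simp: ultra_group_def eventually_conj_iff)

lemma nf_order_iff:
  assumes "\<forall>\<^sub>F i in F. f i \<in> carrier (G i)" "\<forall>\<^sub>F i in F. g i \<in> carrier (G i)"
  shows "(nf f, nf g) \<in> order_rel U \<longleftrightarrow> (\<forall>\<^sub>F i in F. (f i, g i) \<in> order_rel (G i))"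
proof -
  have "\<forall>\<^sub>F i in F. (nf f i, nf g i) \<in> order_rel (G i) \<longleftrightarrow> (f i, g i) \<in> order_rel (G i)"
    using eventually_ultra_nf[of F f] eventually_ultra_nf[of F g] by eventually_elim simp
  then have "(\<forall>\<^sub>F i in F. (nf f i, nf g i) \<in> order_rel (G i)) \<longleftrightarrow> (\<forall>\<^sub>F i in F. (f i, g i) \<in> order_rel (G i))"
    by (rule eventually_subst)
  then show ?thesis using nf_mem assms by (simp add: order_iff)
qed

lemma mult_eq: "f \<otimes>\<^bsub>U\<^esub> g = nf (\<lambda>i. f i \<otimes>\<^bsub>G i\<^esub> g i)"
  and one_eq: "\<one>\<^bsub>U\<^esub> = nf (\<lambda>i. \<one>\<^bsub>G i\<^esub>)"
  and reify_eq: "reify U q = nf (\<lambda>i. reify (G i) q)"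
  by (simp_all add: ultra_group_def)

lemma nf_mult: "nf f \<otimes>\<^bsub>U\<^esub> nf g = nf (\<lambda>i. f i \<otimes>\<^bsub>G i\<^esub> g i)"
  unfolding mult_eq
  by (rule ultra_nf_cong)
    (use eventually_ultra_nf[of F f] eventually_ultra_nf[of F g] in eventually_elim, simp)

lemma eventually_group: "\<forall>\<^sub>F i in F. comm_group (G i)"
  using eventually_reified by eventually_elim (simp add: reified_value_group_def value_group_def)

lemma reify_mem: "0 < q \<Longrightarrow> \<forall>\<^sub>F i in F. reify (G i) q \<in> carrier (G i)"
  using eventually_reified by eventually_elim (rule reified_value_group.reify_closed)

lemma comm_group_ultra: "comm_group U"
proof (rule comm_groupI)
  have one: "\<forall>\<^sub>F i in F. \<one>\<^bsub>G i\<^esub> \<in> carrier (G i)"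
    using eventually_group by eventually_elim (simp add: comm_group.axioms(2) group.is_monoid)
  then show "\<one>\<^bsub>U\<^esub> \<in> carrier U" unfolding one_eq by (rule nf_mem)
  fix x y assume x: "x \<in> carrier U" and y: "y \<in> carrier U"
  have xy: "\<forall>\<^sub>F i in F. x i \<otimes>\<^bsub>G i\<^esub> y i \<in> carrier (G i)"
    using eventually_group carrierD[OF x] carrierD[OF y]
    by eventually_elim (simp add: comm_group.axioms(2) group.is_monoid monoid.m_closed)
  then show xyU: "x \<otimes>\<^bsub>U\<^esub> y \<in> carrier U" unfolding mult_eq by (rule nf_mem)
  show "x \<otimes>\<^bsub>U\<^esub> y = y \<otimes>\<^bsub>U\<^esub> x"
    unfolding mult_eq
  proof (rule ultra_nf_cong)
    show "\<forall>\<^sub>F i in F. x i \<otimes>\<^bsub>G i\<^esub> y i = y i \<otimes>\<^bsub>G i\<^esub> x i"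
      using eventually_group carrierD[OF x] carrierD[OF y]
      by eventually_elim (simp add: comm_group.axioms(1) comm_monoid.m_comm)
  qed
  show "\<one>\<^bsub>U\<^esub> \<otimes>\<^bsub>U\<^esub> x = x"
  proof -
    have "\<forall>\<^sub>F i in F. \<one>\<^bsub>U\<^esub> i \<otimes>\<^bsub>G i\<^esub> x i = x i"
      using eventually_group carrierD[OF x] eventually_ultra_nf[of F "\<lambda>i. \<one>\<^bsub>G i\<^esub>"] unfolding one_eq
      by eventually_elim (simp add: comm_group.axioms(2) group.is_monoid)
    then show ?thesis unfolding mult_eq by (rule nf_eqI[OF x])
  qed
  show "\<exists>y\<in>carrier U. y \<otimes>\<^bsub>U\<^esub> x = \<one>\<^bsub>U\<^esub>"
  proof (rule bexI)
    have "\<forall>\<^sub>F i in F. inv\<^bsub>G i\<^esub> x i \<in> carrier (G i)"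
      using eventually_group carrierD[OF x]
      by eventually_elim (simp add: comm_group.axioms(2) group.inv_closed)
    then show "nf (\<lambda>i. inv\<^bsub>G i\<^esub> x i) \<in> carrier U" by (rule nf_mem)
    have "nf (\<lambda>i. inv\<^bsub>G i\<^esub> x i) \<otimes>\<^bsub>U\<^esub> nf x = \<one>\<^bsub>U\<^esub>"
      unfolding nf_mult one_eq
    proof (rule ultra_nf_cong)
      show "\<forall>\<^sub>F i in F. inv\<^bsub>G i\<^esub> x i \<otimes>\<^bsub>G i\<^esub> x i = \<one>\<^bsub>G i\<^esub>"
        using eventually_group carrierD[OF x]
        by eventually_elim (simp add: comm_group.axioms(2) group.l_inv)
    qed
    then show "nf (\<lambda>i. inv\<^bsub>G i\<^esub> x i) \<otimes>\<^bsub>U\<^esub> x = \<one>\<^bsub>U\<^esub>" by (simp add: nf_carrier x)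
  qed
  fix z assume z: "z \<in> carrier U"
  have "(nf x \<otimes>\<^bsub>U\<^esub> nf y) \<otimes>\<^bsub>U\<^esub> nf z = nf x \<otimes>\<^bsub>U\<^esub> (nf y \<otimes>\<^bsub>U\<^esub> nf z)"
    unfolding nf_mult
  proof (rule ultra_nf_cong)
    show "\<forall>\<^sub>F i in F. x i \<otimes>\<^bsub>G i\<^esub> y i \<otimes>\<^bsub>G i\<^esub> z i = x i \<otimes>\<^bsub>G i\<^esub> (y i \<otimes>\<^bsub>G i\<^esub> z i)"
      using eventually_group carrierD[OF x] carrierD[OF y] carrierD[OF z]
      by eventually_elim (simp add: comm_group.axioms(2) group.is_monoid monoid.m_assoc)
  qed
  then show "x \<otimes>\<^bsub>U\<^esub> y \<otimes>\<^bsub>U\<^esub> z = x \<otimes>\<^bsub>U\<^esub> (y \<otimes>\<^bsub>U\<^esub> z)"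
    by (simp add: nf_carrier x y z)
qed

lemma eventually_value_group: "\<forall>\<^sub>F i in F. value_group (G i)"
  using eventually_reified by eventually_elim (rule reified_value_group.axioms(1))

lemma linear_order_ultra: "linear_order_on (carrier U) (order_rel U)"
  unfolding order_on_defs
proof (intro conjI)
  show "order_rel U \<subseteq> carrier U \<times> carrier U" by (auto simp: order_iff)
  show "refl_on (carrier U) (order_rel U)"
  proof (rule refl_onI)
    fix x assume x: "x \<in> carrier U"
    have "\<forall>\<^sub>F i in F. (x i, x i) \<in> order_rel (G i)"
      using eventually_value_group carrierD[OF x] by eventually_elim (rule value_group.ord_refl)
    then show "(x, x) \<in> order_rel U" using x by (simp add: order_iff)
  qed
  show "trans (order_rel U)"
  proof (rule transI)
    fix x y z assume xy: "(x, y) \<in> order_rel U" and yz: "(y, z) \<in> order_rel U"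
    have "\<forall>\<^sub>F i in F. (x i, y i) \<in> order_rel (G i)" "\<forall>\<^sub>F i in F. (y i, z i) \<in> order_rel (G i)"
      using xy yz by (simp_all add: order_iff)
    with eventually_value_group have "\<forall>\<^sub>F i in F. (x i, z i) \<in> order_rel (G i)"
      by eventually_elim (rule value_group.ord_trans)
    then show "(x, z) \<in> order_rel U" using xy yz by (simp add: order_iff)
  qed
  show "antisym (order_rel U)"
  proof (rule antisymI)
    fix x y assume xy: "(x, y) \<in> order_rel U" and yx: "(y, x) \<in> order_rel U"
    have "\<forall>\<^sub>F i in F. (x i, y i) \<in> order_rel (G i)" "\<forall>\<^sub>F i in F. (y i, x i) \<in> order_rel (G i)"
      using xy yx by (simp_all add: order_iff)
    with eventually_value_group have "\<forall>\<^sub>F i in F. x i = y i"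
      by eventually_elim (rule value_group.ord_antisym)
    then have "nf x = y" using xy by (intro nf_eqI) (simp_all add: order_iff)
    then show "x = y" using xy by (simp add: order_iff nf_carrier)
  qed
  show "total_on (carrier U) (order_rel U)"
  proof (rule total_onI)
    fix x y assume x: "x \<in> carrier U" and y: "y \<in> carrier U"
    show "(x, y) \<in> order_rel U \<or> (y, x) \<in> order_rel U"
    \<comment> \<open>Totality rests on the ultrafilter property: if x \<le> y does not hold almost
      everywhere, its negation does, and totality in the \<open>G i\<close> gives the reverse
      inequality.\<close>
    proof (cases "\<forall>\<^sub>F i in F. (x i, y i) \<in> order_rel (G i)")
      case False
      then have "\<forall>\<^sub>F i in F. (x i, y i) \<notin> order_rel (G i)" by (simp add: not_eventually_iff)
      with eventually_value_group carrierD[OF x] carrierD[OF y]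
      have "\<forall>\<^sub>F i in F. (y i, x i) \<in> order_rel (G i)"
        by eventually_elim (metis value_group.ord_total)
      then show ?thesis using x y by (simp add: order_iff)
    qed (use x y in \<open>simp add: order_iff\<close>)
  qed
qed

lemma reified_value_group_ultra: "reified_value_group U"
proof -
  interpret U: comm_group U by (rule comm_group_ultra)
  show ?thesis
  proof unfold_locales
    show "linear_order_on (carrier U) (order_rel U)" by (rule linear_order_ultra)
  next
    fix x y z assume xy: "(x, y) \<in> order_rel U" and z: "z \<in> carrier U"
    have x: "x \<in> carrier U" and y: "y \<in> carrier U" using xy by (simp_all add: order_iff)
    have mem: "\<forall>\<^sub>F i in F. z i \<otimes>\<^bsub>G i\<^esub> t i \<in> carrier (G i)" if "t \<in> carrier U" for t
      using eventually_group carrierD[OF z] carrierD[OF that]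
      by eventually_elim (simp add: comm_group.axioms(2) group.is_monoid monoid.m_closed)
    have "\<forall>\<^sub>F i in F. (x i, y i) \<in> order_rel (G i)" using xy by (simp add: order_iff)
    with eventually_value_group carrierD[OF z]
    have "\<forall>\<^sub>F i in F. (z i \<otimes>\<^bsub>G i\<^esub> x i, z i \<otimes>\<^bsub>G i\<^esub> y i) \<in> order_rel (G i)"
      by eventually_elim (rule value_group.mult_left_mono)
    then show "(z \<otimes>\<^bsub>U\<^esub> x, z \<otimes>\<^bsub>U\<^esub> y) \<in> order_rel U"
      unfolding mult_eq by (simp add: nf_order_iff mem x y)
  next
    have "\<forall>\<^sub>F i in F. reify (G i) (p * q) = reify (G i) p \<otimes>\<^bsub>G i\<^esub> reify (G i) q" if "0 < p" "0 < q" for p q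
      using eventually_reified by eventually_elim (rule reified_value_group.reify_mult[OF _ that])
    then show "reify U \<in> hom positive_reals U"
      by (auto simp: hom_def positive_reals_def reify_eq nf_mult intro!: nf_mem reify_mem ultra_nf_cong)
  next
    fix p q :: real assume pq: "0 < p" "p \<le> q"
    have "\<forall>\<^sub>F i in F. (reify (G i) p, reify (G i) q) \<in> order_rel (G i)"
      using eventually_reified by eventually_elim (rule reified_value_group.reify_mono[OF _ pq])
    then show "(reify U p, reify U q) \<in> order_rel U"
      unfolding reify_eq using pq by (simp add: nf_order_iff reify_mem)
  qed
qed

end

section \<open>The truncated ultraproduct\<close>

text \<open>In \<open>bounded\<close>, one constant \<open>s\<close> serves almost all indices. For
  the spectrum it comes from the seminorm of \<open>a\<close>; it keeps the values of ring elements
  in the ultraproduct below reals.\<close>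

locale rsv_ultraproduct = A: cring A + ultrafilter F
  for A :: "('a, 'k) ring_scheme" and F :: "'i filter" +
  fixes G :: "'i \<Rightarrow> 'g reified_monoid" and v :: "'i \<Rightarrow> 'a \<Rightarrow> 'g option"
  assumes eventually_rsv: "\<forall>\<^sub>F i in F. rsv A (G i) (v i)"
    and bounded: "a \<in> carrier A \<Longrightarrow> \<exists>s>0. \<forall>\<^sub>F i in F. dominated (G i) (v i) a s \<one>\<^bsub>A\<^esub>"
begin

sublocale ultra_reified F G
  by unfold_locales (use eventually_rsv in eventually_elim, simp add: rsv_def)

text \<open>The values below all positive reals are sent to zero. This cuts the ultraproduct down to the
  convex subgroup generated by the reals.\<close>

definition noninf :: "'a \<Rightarrow> bool" where
  "noninf a \<longleftrightarrow> (\<exists>r>0. \<forall>\<^sub>F i in F. dominated (G i) (v i) \<one>\<^bsub>A\<^esub> r a)"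

definition limit_rsv :: "'a \<Rightarrow> ('i \<Rightarrow> 'g) option" where
  "limit_rsv a = (if noninf a then Some (nf (\<lambda>i. the (v i a))) else None)"

lemma noninf_val:
  assumes "noninf a" "a \<in> carrier A"
  shows "\<forall>\<^sub>F i in F. v i a \<noteq> None" "\<forall>\<^sub>F i in F. the (v i a) \<in> carrier (G i)"
proof -
  obtain r where "\<forall>\<^sub>F i in F. dominated (G i) (v i) \<one>\<^bsub>A\<^esub> r a"
    using assms(1) by (auto simp: noninf_def)
  with eventually_rsv show *: "\<forall>\<^sub>F i in F. v i a \<noteq> None"
    by eventually_elim (rule rsv.dominated_nonzero)
  with eventually_rsv show "\<forall>\<^sub>F i in F. the (v i a) \<in> carrier (G i)"
    by eventually_elim (rule rsv.val_closed[OF _ assms(2)])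
qed

lemma noninf_upward:
  assumes "noninf a" "0 < q" "\<forall>\<^sub>F i in F. dominated (G i) (v i) a q b" "a \<in> carrier A" "b \<in> carrier A"
  shows "noninf b"
proof -
  obtain r where r: "0 < r" "\<forall>\<^sub>F i in F. dominated (G i) (v i) \<one>\<^bsub>A\<^esub> r a"
    using assms(1) by (auto simp: noninf_def)
  from eventually_rsv r(2) assms(3) have "\<forall>\<^sub>F i in F. dominated (G i) (v i) \<one>\<^bsub>A\<^esub> (r * q) b"
    by eventually_elim (rule rsv.dominated_trans, use assms r in auto)
  then show ?thesis unfolding noninf_def using r assms(2) by (intro exI[of _ "r * q"]) auto
qed

lemma noninf_one: "noninf \<one>\<^bsub>A\<^esub>"
proof -
  have "\<forall>\<^sub>F i in F. dominated (G i) (v i) \<one>\<^bsub>A\<^esub> 1 \<one>\<^bsub>A\<^esub>"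
    using eventually_rsv by eventually_elim (simp add: rsv.dominated_refl_iff rsv.v_one)
  then show ?thesis unfolding noninf_def by (intro exI[of _ 1]) simp
qed

text \<open>An infinitesimal factor makes the product infinitesimal because the other factor is
  bounded by a real. With the converse, the elements outside \<open>noninf\<close> behave under
  multiplication like a prime ideal, as the support of a semivaluation must.\<close>

lemma noninf_mult_iff:
  assumes a: "a \<in> carrier A" and b: "b \<in> carrier A"
  shows "noninf (a \<otimes>\<^bsub>A\<^esub> b) \<longleftrightarrow> noninf a \<and> noninf b"
proof
  have left: "noninf a" if ab: "noninf (a \<otimes>\<^bsub>A\<^esub> b)" and a: "a \<in> carrier A" and b: "b \<in> carrier A" for a b
  proof -
    obtain s where s: "0 < s" "\<forall>\<^sub>F i in F. dominated (G i) (v i) b s \<one>\<^bsub>A\<^esub>" using bounded[OF b] by blast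
    have "\<forall>\<^sub>F i in F. v i (a \<otimes>\<^bsub>A\<^esub> b) \<noteq> None" using noninf_val[OF ab] a b by simp
    with eventually_rsv s(2) have "\<forall>\<^sub>F i in F. dominated (G i) (v i) (a \<otimes>\<^bsub>A\<^esub> b) s a"
    proof eventually_elim
      case (elim i)
      interpret V: rsv A "G i" "v i" by (rule elim)
      have "V.D a 1 a" using elim(3) a b by (simp add: V.v_mult_None V.dominated_refl_iff)
      from V.dominated_mult[OF this elim(2)] show ?case using a b s by simp
    qed
    then show ?thesis using noninf_upward[OF ab s(1)] a b by simp
  qed
  show "noninf a \<and> noninf b" if "noninf (a \<otimes>\<^bsub>A\<^esub> b)"
    using left[OF that a b] left[of b a] that a b by (simp add: A.m_comm)
  assume "noninf a \<and> noninf b"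
  then obtain r s where r: "0 < r" "\<forall>\<^sub>F i in F. dominated (G i) (v i) \<one>\<^bsub>A\<^esub> r a"
    and s: "0 < s" "\<forall>\<^sub>F i in F. dominated (G i) (v i) \<one>\<^bsub>A\<^esub> s b"
    by (auto simp: noninf_def)
  from eventually_rsv r(2) s(2) have "\<forall>\<^sub>F i in F. dominated (G i) (v i) \<one>\<^bsub>A\<^esub> (r * s) (a \<otimes>\<^bsub>A\<^esub> b)"
  proof eventually_elim
    case (elim i)
    interpret V: rsv A "G i" "v i" by (rule elim)
    from V.dominated_mult[OF elim(2,3)] show ?case using a b r s by simp
  qed
  then show "noninf (a \<otimes>\<^bsub>A\<^esub> b)" unfolding noninf_def using r s by (intro exI[of _ "r * s"]) auto
qed

lemma limit_rsv_mem: "a \<in> carrier A \<Longrightarrow> limit_rsv a \<in> insert None (Some ` carrier U)"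
  by (auto simp: limit_rsv_def intro!: nf_mem noninf_val)

text \<open>Los's theorem for domination, with \<open>noninf b\<close> as the only trace of the
  truncation. When \<open>a\<close> is truncated and \<open>b\<close> is not, the left-hand side
  holds trivially, and the right-hand side holds because v(a) lies below all positive reals and v(b)
  above one of them.\<close>

lemma limit_rsv_dominated:
  assumes a: "a \<in> carrier A" and b: "b \<in> carrier A" and q: "0 < q"
  shows "dominated U limit_rsv a q b \<longleftrightarrow> noninf b \<and> (\<forall>\<^sub>F i in F. dominated (G i) (v i) a q b)"
proof (cases "noninf b")
  case True
  note nb = noninf_val[OF True b]
  show ?thesis
  proof (cases "noninf a")
    case na: True
    have "\<forall>\<^sub>F i in F. reify (G i) q \<otimes>\<^bsub>G i\<^esub> the (v i b) \<in> carrier (G i)"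
      using eventually_group reify_mem[OF q] nb(2)
      by eventually_elim (simp add: comm_group.axioms(2) group.is_monoid monoid.m_closed)
    then have "dominated U limit_rsv a q b \<longleftrightarrow>
        (\<forall>\<^sub>F i in F. (the (v i a), reify (G i) q \<otimes>\<^bsub>G i\<^esub> the (v i b)) \<in> order_rel (G i))"
      using na True noninf_val(2)[OF na a]
      by (simp add: dominated_def limit_rsv_def reify_eq nf_mult nf_order_iff)
    also have "\<dots> \<longleftrightarrow> (\<forall>\<^sub>F i in F. dominated (G i) (v i) a q b)"
    proof (rule eventually_subst)
      show "\<forall>\<^sub>F i in F. ((the (v i a), reify (G i) q \<otimes>\<^bsub>G i\<^esub> the (v i b)) \<in> order_rel (G i)) =
          dominated (G i) (v i) a q b"
        using eventually_rsv nb(1) noninf_val(1)[OF na a]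
        by eventually_elim (simp add: rsv.dominated_iff)
    qed
    finally show ?thesis using True by simp
  next
    case False
    obtain r where r: "0 < r" "\<forall>\<^sub>F i in F. dominated (G i) (v i) \<one>\<^bsub>A\<^esub> r b"
      using True by (auto simp: noninf_def)
    \<comment> \<open>The constant is chosen so that the failure of 1 \<le> (r / q) v(a) gives v(a)
      \<le> q / r by totality; with 1 \<le> r v(b) this becomes v(a) \<le> q v(b).\<close>
    have "\<not> (\<forall>\<^sub>F i in F. dominated (G i) (v i) \<one>\<^bsub>A\<^esub> (r / q) a)"
      using False r q by (auto simp: noninf_def)
    then have "\<forall>\<^sub>F i in F. \<not> dominated (G i) (v i) \<one>\<^bsub>A\<^esub> (r / q) a" by (simp add: not_eventually_iff)
    with eventually_rsv r(2) have "\<forall>\<^sub>F i in F. dominated (G i) (v i) a q b"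
    proof eventually_elim
      case (elim i)
      interpret V: rsv A "G i" "v i" by (rule elim)
      have "V.D a (q / r) \<one>\<^bsub>A\<^esub>"
        using V.dominated_total[of a "\<one>\<^bsub>A\<^esub>" "q / r"] elim(3) a r q by auto
      from V.dominated_trans[OF this elim(2)] show ?case using a b r q by simp
    qed
    then show ?thesis using True False by (simp add: dominated_def limit_rsv_def)
  qed
qed (simp add: dominated_def limit_rsv_def)

text \<open>The group remains the full ultraproduct \<open>U\<close>; only the value subgroup
  shrinks, and equivalence of semivaluations sees nothing else.\<close>

lemma rsv_limit: "rsv A U limit_rsv"
proof -
  interpret U: reified_value_group U by (rule reified_value_group_ultra)
  have "semivaluation A U limit_rsv"
    unfolding semivaluation_def
  proof (intro conjI ballI funcsetI)
    show "value_group U" by (rule U.value_group_axioms)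
    show "limit_rsv a \<in> insert None (Some ` carrier U)" if "a \<in> carrier A" for a
      using that by (rule limit_rsv_mem)
    have "\<not> noninf \<zero>\<^bsub>A\<^esub>"
    proof
      assume "noninf \<zero>\<^bsub>A\<^esub>"
      from eventually_rsv noninf_val(1)[OF this A.zero_closed] have "\<forall>\<^sub>F i in F. False"
        by eventually_elim (simp add: rsv.v_zero)
      then show False using proper by simp
    qed
    then show "limit_rsv \<zero>\<^bsub>A\<^esub> = None" by (simp add: limit_rsv_def)
    have "nf (\<lambda>i. the (v i \<one>\<^bsub>A\<^esub>)) = \<one>\<^bsub>U\<^esub>"
      unfolding one_eq by (rule ultra_nf_cong) (use eventually_rsv in eventually_elim, simp add: rsv.v_one)
    then show "limit_rsv \<one>\<^bsub>A\<^esub> = Some \<one>\<^bsub>U\<^esub>" by (simp add: limit_rsv_def noninf_one)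
  next
    fix x y assume x: "x \<in> carrier A" and y: "y \<in> carrier A"
    \<comment> \<open>An inequality that holds almost everywhere survives the truncation, because an
      element above one in \<open>noninf\<close> is itself in \<open>noninf\<close>.\<close>
    have le: "le0 U (limit_rsv s) (limit_rsv t)"
      if "\<forall>\<^sub>F i in F. le0 (G i) (v i s) (v i t)" and s: "s \<in> carrier A" and t: "t \<in> carrier A" for s t
    proof (cases "noninf s")
      case ns: True
      have *: "\<forall>\<^sub>F i in F. dominated (G i) (v i) s 1 t \<and> (the (v i s), the (v i t)) \<in> order_rel (G i)"
        using eventually_rsv noninf_val(1)[OF ns s] that(1)
      proof eventually_elim
        case (elim i)
        interpret V: rsv A "G i" "v i" by (rule elim)
        show ?case using elim(2,3) t
          by (cases "v i s"; cases "v i t") (auto simp: V.dominated_iff V.G.reify_one dest: rsv_value_closed[OF V.reified])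
      qed
      then have nt: "noninf t"
        using noninf_upward[OF ns zero_less_one] s t by (simp add: eventually_conj_iff)
      show ?thesis
        using * ns nt noninf_val(2)[OF ns s] noninf_val(2)[OF nt t]
        by (simp add: limit_rsv_def nf_order_iff eventually_conj_iff)
    qed (simp add: limit_rsv_def)
    \<comment> \<open>Which summand bounds the sum may vary with the index; the ultrafilter settles
      on one of the two.\<close>
    have "(\<forall>\<^sub>F i in F. le0 (G i) (v i (x \<oplus>\<^bsub>A\<^esub> y)) (v i x)) \<or> (\<forall>\<^sub>F i in F. le0 (G i) (v i (x \<oplus>\<^bsub>A\<^esub> y)) (v i y))"
    proof (rule disjCI)
      assume "\<not> (\<forall>\<^sub>F i in F. le0 (G i) (v i (x \<oplus>\<^bsub>A\<^esub> y)) (v i y))"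
      then have "\<forall>\<^sub>F i in F. \<not> le0 (G i) (v i (x \<oplus>\<^bsub>A\<^esub> y)) (v i y)" by (simp add: not_eventually_iff)
      with eventually_rsv show "\<forall>\<^sub>F i in F. le0 (G i) (v i (x \<oplus>\<^bsub>A\<^esub> y)) (v i x)"
        by eventually_elim (use rsv.v_add[OF _ x y] in blast)
    qed
    then show "le0 U (limit_rsv (x \<oplus>\<^bsub>A\<^esub> y)) (max0 U (limit_rsv x) (limit_rsv y))"
      using x y by (intro U.le0_max0I limit_rsv_mem) (auto intro: le)
    show "limit_rsv (x \<otimes>\<^bsub>A\<^esub> y) = mult0 U (limit_rsv x) (limit_rsv y)"
    proof (cases "noninf x \<and> noninf y")
      case True
      have "nf (\<lambda>i. the (v i (x \<otimes>\<^bsub>A\<^esub> y))) = nf (\<lambda>i. the (v i x) \<otimes>\<^bsub>G i\<^esub> the (v i y))"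
      proof (rule ultra_nf_cong)
        from True have "\<forall>\<^sub>F i in F. v i x \<noteq> None" "\<forall>\<^sub>F i in F. v i y \<noteq> None"
          using noninf_val x y by auto
        with eventually_rsv show "\<forall>\<^sub>F i in F. the (v i (x \<otimes>\<^bsub>A\<^esub> y)) = the (v i x) \<otimes>\<^bsub>G i\<^esub> the (v i y)"
          by eventually_elim (rule rsv.val_mult[OF _ x y])
      qed
      then show ?thesis using True x y by (simp add: limit_rsv_def noninf_mult_iff nf_mult)
    next
      case False
      then show ?thesis using x y by (auto simp: limit_rsv_def noninf_mult_iff)
    qed
  qed
  then show ?thesis by (simp add: rsv_def rsv_axioms_def A.cring_axioms U.reified_value_group_axioms)
qed

end

text \<open>\<open>bounded\<close> makes \<open>J\<close> absorb multiplication by \<open>x\<close>,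
  at the cost of a factor \<open>s\<close> in the constant, and membership of \<one> in
  \<open>J\<close> is exactly \<open>noninf b\<close>. A member of \<open>S\<close> is needed to
  start: even \<zero> lies in \<open>J\<close> only if \<open>b\<close> has a nonzero value almost
  everywhere.\<close>

lemma (in rsv_ultraproduct) noninf_of_unit_ideal:
  assumes S: "S \<subseteq> carrier A" "S \<noteq> {}" "Idl\<^bsub>A\<^esub> S = carrier A" and b: "b \<in> carrier A"
    and dom: "\<And>a. a \<in> S \<Longrightarrow> \<exists>r>0. \<forall>\<^sub>F i in F. dominated (G i) (v i) a r b"
  shows "noninf b"
proof -
  define J where "J = {a \<in> carrier A. \<exists>r>0. \<forall>\<^sub>F i in F. dominated (G i) (v i) a r b}"
  have SJ: "S \<subseteq> J" using S(1) dom by (auto simp: J_def)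
  have mult: "x \<otimes>\<^bsub>A\<^esub> a \<in> J" if "a \<in> J" and x: "x \<in> carrier A" for a x
  proof -
    obtain r where a: "a \<in> carrier A" "0 < r" "\<forall>\<^sub>F i in F. dominated (G i) (v i) a r b"
      using \<open>a \<in> J\<close> by (auto simp: J_def)
    obtain s where s: "0 < s" "\<forall>\<^sub>F i in F. dominated (G i) (v i) x s \<one>\<^bsub>A\<^esub>" using bounded[OF x] by blast
    from eventually_rsv a(3) s(2) have "\<forall>\<^sub>F i in F. dominated (G i) (v i) (x \<otimes>\<^bsub>A\<^esub> a) (s * r) b"
    proof eventually_elim
      case (elim i)
      interpret V: rsv A "G i" "v i" by (rule elim)
      from V.dominated_mult[OF elim(3,2)] show ?case using a b s x by simp
    qed
    then show ?thesis unfolding J_def using a s x by (auto intro!: exI[of _ "s * r"])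
  qed
  have add: "a \<oplus>\<^bsub>A\<^esub> c \<in> J" if "a \<in> J" "c \<in> J" for a c
  proof -
    obtain r where a: "a \<in> carrier A" "0 < r" "\<forall>\<^sub>F i in F. dominated (G i) (v i) a r b"
      using \<open>a \<in> J\<close> by (auto simp: J_def)
    obtain s where c: "c \<in> carrier A" "0 < s" "\<forall>\<^sub>F i in F. dominated (G i) (v i) c s b"
      using \<open>c \<in> J\<close> by (auto simp: J_def)
    from eventually_rsv a(3) c(3) have "\<forall>\<^sub>F i in F. dominated (G i) (v i) (a \<oplus>\<^bsub>A\<^esub> c) (max r s) b"
    proof eventually_elim
      case (elim i)
      interpret V: rsv A "G i" "v i" by (rule elim)
      have "V.D a (max r s) b" "V.D c (max r s) b"
        using V.dominated_mono[OF elim(2), of "max r s"] V.dominated_mono[OF elim(3), of "max r s"] a c b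
        by auto
      then show ?case using a b c by (intro V.dominated_add) auto
    qed
    then show ?thesis unfolding J_def using a c by (auto intro!: exI[of _ "max r s"])
  qed
  have neg: "\<ominus>\<^bsub>A\<^esub> a \<in> J" if "a \<in> J" for a
  proof -
    have "a \<in> carrier A" using that by (simp add: J_def)
    then have "\<ominus>\<^bsub>A\<^esub> a = (\<ominus>\<^bsub>A\<^esub> \<one>\<^bsub>A\<^esub>) \<otimes>\<^bsub>A\<^esub> a" by (simp add: A.l_minus)
    then show ?thesis using mult[OF that, of "\<ominus>\<^bsub>A\<^esub> \<one>\<^bsub>A\<^esub>"] by simp
  qed
  have "ideal J A"
  proof (rule idealI)
    show "ring A" by (rule A.ring_axioms)
    have "J \<subseteq> carrier A" "J \<noteq> {}" using SJ S(2) by (auto simp: J_def)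
    then show "subgroup J (add_monoid A)"
      using add neg by (intro A.add.subgroupI) (auto simp: a_inv_def)
    show "x \<otimes>\<^bsub>A\<^esub> a \<in> J" if "a \<in> J" "x \<in> carrier A" for a x by (rule mult[OF that])
    show "a \<otimes>\<^bsub>A\<^esub> x \<in> J" if "a \<in> J" "x \<in> carrier A" for a x
      using mult[OF that] that by (simp add: J_def A.m_comm)
  qed
  then have "carrier A \<subseteq> J" using A.genideal_minimal[of J S] SJ S(3) by simp
  then show ?thesis by (auto simp: J_def noninf_def)
qed

section \<open>The reified adic spectrum\<close>

definition class_dominated :: "'a small_rsv set \<Rightarrow> 'a \<Rightarrow> real \<Rightarrow> 'a \<Rightarrow> bool" where
  "class_dominated c a q b \<longleftrightarrow> (\<exists>(G, v)\<in>c. dominated G v a q b)"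

lemma Sprv_set_nonempty:
  assumes "c \<in> Sprv_set A"
  obtains G v where "(G, v) \<in> c"
  using in_quotient_imp_non_empty[OF equiv_rsv_rel assms[unfolded Sprv_set_def]] by auto

lemma Sprv_set_ex_iff:
  assumes c: "c \<in> Sprv_set A" and P: "\<And>G v. (G, v) \<in> c \<Longrightarrow> P G v \<longleftrightarrow> Q"
  shows "(\<exists>(G, v)\<in>c. P G v) \<longleftrightarrow> Q"
proof
  assume Q
  obtain G v where Gv: "(G, v) \<in> c" by (rule Sprv_set_nonempty[OF c])
  then have "P G v" using P \<open>Q\<close> by simp
  then show "\<exists>(G, v)\<in>c. P G v" using Gv by blast
qed (use P in auto)

lemma Sprv_set_reified:
  assumes "c \<in> Sprv_set A" "(G, v) \<in> c"
  shows "reified_semivaluation A G v"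
  using in_quotient_imp_subset[OF equiv_rsv_rel assms(1)[unfolded Sprv_set_def]] assms(2)
  by (auto simp: small_rsvs_def)

lemma Sprv_set_equivalent:
  assumes "c \<in> Sprv_set A" "(G, v) \<in> c" "(H, w) \<in> c"
  shows "rsv_equivalent A G v H w"
  using in_quotient_imp_in_rel[OF equiv_rsv_rel assms(1)[unfolded Sprv_set_def], of "(G, v)" "(H, w)"] assms(2,3)
  by (auto simp: rsv_rel_def)

lemma class_dominated_iff:
  assumes A: "cring A" and c: "c \<in> Sprv_set A" "(G, v) \<in> c"
    and "a \<in> carrier A" "b \<in> carrier A" "0 < q"
  shows "class_dominated c a q b \<longleftrightarrow> dominated G v a q b"
proof -
  have "dominated H w a q b \<longleftrightarrow> dominated G v a q b" if "(H, w) \<in> c" for H w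
    using dominated_equivalent[OF A Sprv_set_reified[OF c(1) that] Sprv_set_reified[OF c]
      Sprv_set_equivalent[OF c(1) that c(2)] assms(4-6)] .
  then show ?thesis using c(2) unfolding class_dominated_def by blast
qed

section \<open>Points of the spectrum in terms of domination\<close>

context nonarch_seminormed_ring
begin

text \<open>The exponent starts at one, since \<open>seminorm A \<one>\<close> may exceed 1 and the
  bound would then fail for the power zero.\<close>

lemma seminorm_pow_le:
  assumes a: "a \<in> carrier A"
  shows "seminorm A (a [^] Suc n) \<le> seminorm A a ^ Suc n"
proof (induction n)
  case (Suc n)
  have "seminorm A (a [^] Suc (Suc n)) \<le> seminorm A (a [^] Suc n) * seminorm A a"
    using seminorm_mult[of "a [^] Suc n" a] a by (simp del: nat_pow_Suc add: nat_pow_Suc[of a "Suc n"])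
  also have "\<dots> \<le> seminorm A a ^ Suc n * seminorm A a"
    by (rule mult_right_mono[OF Suc seminorm_nonneg[OF a]])
  finally show ?case by (simp add: mult.commute)
qed (use a in simp)

text \<open>For positive \<open>n\<close> the quotients are at most the powers of |a| / r < 1. Every
  ring element thus has degrees in which it is topologically nilpotent, and so real upper bounds
  under all bounded semivaluations.\<close>

lemma top_nilpotent_if_less:
  assumes a: "a \<in> carrier A" and r: "seminorm A a < r"
  shows "a \<in> top_nilpotent A r"
proof -
  have "0 < r" using seminorm_nonneg[OF a] r by linarith
  have "(\<lambda>n. (seminorm A a / r) ^ Suc n) \<longlonglongrightarrow> 0"
    by (rule LIMSEQ_Suc, rule LIMSEQ_realpow_zero) (use seminorm_nonneg[OF a] r in auto)
  then have "(\<lambda>n. seminorm A (a [^] Suc n) / r ^ Suc n) \<longlonglongrightarrow> 0"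
  proof (rule tendsto_sandwich[OF _ _ tendsto_const, rotated 2])
    show "\<forall>\<^sub>F n in sequentially. 0 \<le> seminorm A (a [^] Suc n) / r ^ Suc n"
      using \<open>0 < r\<close> a seminorm_nonneg by (intro always_eventually) (simp del: nat_pow_Suc)
    show "\<forall>\<^sub>F n in sequentially. seminorm A (a [^] Suc n) / r ^ Suc n \<le> (seminorm A a / r) ^ Suc n"
      using \<open>0 < r\<close> seminorm_pow_le[OF a]
      by (intro always_eventually) (simp add: power_divide divide_right_mono del: nat_pow_Suc power_Suc)
  qed
  then have "(\<lambda>n. seminorm A (a [^] n) / r ^ n) \<longlonglongrightarrow> 0" by (rule LIMSEQ_imp_Suc)
  then show ?thesis using a by (simp add: top_nilpotent_def)
qed

text \<open>Membership in the spectrum as a property of a ternary relation, so that it can be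
  checked for a limit known only through its relation. The first clause joins boundedness with the
  condition on the plus parts; the second is commensurability in the form given by
  \<open>coinitial_iff\<close>.\<close>

definition adic_relation :: "(real \<Rightarrow> 'a set) set \<Rightarrow> ('a \<Rightarrow> real \<Rightarrow> 'a \<Rightarrow> bool) \<Rightarrow> bool" where
  "adic_relation B D \<longleftrightarrow> (\<forall>r>0. \<forall>a\<in>top_nilpotent A r \<union> plus_part A B r. D a r \<one>) \<and>
    (\<forall>a\<in>carrier A. D a 1 a \<longrightarrow> (\<exists>r>0. D \<one> r a))"

lemma plus_part_carrier: "top_nilpotent A r \<union> plus_part A B r \<subseteq> carrier A"
  by (auto simp: plus_part_def power_bounded_def top_nilpotent_def)

text \<open>The summand 1 makes the degree strictly larger than the seminorm, as
  \<open>top_nilpotent_if_less\<close> asks. The constant does not depend on \<open>D\<close>, hence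
  is the same at all points.\<close>

lemma adic_relation_bounded:
  assumes "adic_relation B D" "a \<in> carrier A"
  shows "D a (seminorm A a + 1) \<one>"
  using assms top_nilpotent_if_less[of a "seminorm A a + 1"] seminorm_nonneg[of a]
  by (auto simp: adic_relation_def)

lemma adic_relation_cong:
  assumes "\<And>a q b. \<lbrakk>a \<in> carrier A; b \<in> carrier A; 0 < q\<rbrakk> \<Longrightarrow> D a q b \<longleftrightarrow> D' a q b"
  shows "adic_relation B D \<longleftrightarrow> adic_relation B D'"
proof -
  have "D a r \<one> \<longleftrightarrow> D' a r \<one>" if "a \<in> top_nilpotent A r \<union> plus_part A B r" "0 < r" for a r
    using assms[of a \<one> r] that plus_part_carrier by blast
  then have "(\<forall>r>0. \<forall>a\<in>top_nilpotent A r \<union> plus_part A B r. D a r \<one>) \<longleftrightarrow>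
      (\<forall>r>0. \<forall>a\<in>top_nilpotent A r \<union> plus_part A B r. D' a r \<one>)" by blast
  moreover have "(D a 1 a \<longrightarrow> (\<exists>r>0. D \<one> r a)) \<longleftrightarrow> (D' a 1 a \<longrightarrow> (\<exists>r>0. D' \<one> r a))" if a: "a \<in> carrier A" for a
    using assms[OF a a, of 1] assms[OF one_closed a] by auto
  ultimately show ?thesis by (simp add: adic_relation_def)
qed

lemma adic_relation_iff:
  assumes v: "reified_semivaluation A G v"
  shows "adic_relation B (dominated G v) \<longleftrightarrow>
    commensurable_rsv A G v \<and> (\<forall>r>0. \<forall>a\<in>plus_part A B r. le0 G (v a) (Some (reify G r)))"
proof -
  interpret V: rsv A G v using v is_cring by (simp add: rsv_iff)
  have le: "le0 G (v a) (Some (reify G r)) \<longleftrightarrow> dominated G v a r \<one>" if "0 < r" for a r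
    using that by (simp add: dominated_def V.G.reify_closed)
  let ?C = "\<forall>\<gamma>\<in>value_subgroup A G v. \<exists>r>0. (reify G r, \<gamma>) \<in> order_rel G"
  let ?D = "\<forall>a\<in>carrier A. V.D a 1 a \<longrightarrow> (\<exists>r>0. V.D \<one> r a)"
  \<comment> \<open>The two forms of commensurability are compared under boundedness, which is
    available on both sides of the claim.\<close>
  have "?C \<longleftrightarrow> ?D" if "\<forall>r>0. \<forall>a\<in>top_nilpotent A r. V.D a r \<one>"
  proof (rule V.coinitial_iff)
    show "\<exists>s>0. V.D a s \<one>" if "a \<in> carrier A" for a
      using \<open>\<forall>r>0. _\<close> that top_nilpotent_if_less[of a "seminorm A a + 1"] seminorm_nonneg[of a]
      by (intro exI[of _ "seminorm A a + 1"]) auto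
  qed
  then show ?thesis
    unfolding adic_relation_def commensurable_rsv_def bounded_rsv_def by (auto simp: le)
qed

lemma openin_Sprv_generator:
  assumes "a \<in> carrier A" "b \<in> carrier A" "0 < q"
  shows "openin (Sprv A) {c \<in> Sprv_set A. class_dominated c a q b}"
  unfolding Sprv_def class_dominated_def
  by (rule topology_generated_by_Basis) (use assms in blast)

lemma topspace_Sprv: "topspace (Sprv A) = Sprv_set A"
proof
  show "topspace (Sprv A) \<subseteq> Sprv_set A"
    unfolding Sprv_def topology_generated_by_topspace by blast
  have "class_dominated c \<one> 1 \<one>" if c: "c \<in> Sprv_set A" for c
  proof -
    obtain G v where Gv: "(G, v) \<in> c" by (rule Sprv_set_nonempty[OF c])
    interpret V: rsv A G v using Sprv_set_reified[OF c Gv] is_cring by (simp add: rsv_iff)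
    show ?thesis using class_dominated_iff[OF is_cring c Gv, of \<one> \<one> 1] by (simp add: V.dominated_refl_iff)
  qed
  then show "Sprv_set A \<subseteq> topspace (Sprv A)"
    using openin_subset[OF openin_Sprv_generator[of \<one> \<one> 1]] by auto
qed

text \<open>\<open>Comm\<close> and \<open>Spra\<close> each ask for a representative of their own,
  so both conditions are shown to be independent of the representative before they are
  joined.\<close>

lemma topspace_Spra: "topspace (Spra A B) = {c \<in> Sprv_set A. adic_relation B (class_dominated c)}"
proof -
  have "(\<exists>(G, v)\<in>c. commensurable_rsv A G v) \<and>
      (\<exists>(G, v)\<in>c. \<forall>r>0. \<forall>a\<in>plus_part A B r. le0 G (v a) (Some (reify G r))) \<longleftrightarrow>
    adic_relation B (class_dominated c)" if c: "c \<in> Sprv_set A" for c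
  proof -
    have ad: "adic_relation B' (class_dominated c) \<longleftrightarrow>
        commensurable_rsv A G v \<and> (\<forall>r>0. \<forall>a\<in>plus_part A B' r. le0 G (v a) (Some (reify G r)))"
      if "(G, v) \<in> c" for G v B'
      using adic_relation_iff[OF Sprv_set_reified[OF c that], of B']
        adic_relation_cong[of "class_dominated c" "dominated G v" B'] class_dominated_iff[OF is_cring c that]
      by simp
    have plus: "(\<forall>r>0. \<forall>a\<in>plus_part A B r. le0 G (v a) (Some (reify G r))) \<longleftrightarrow>
        (\<forall>r>0. \<forall>a\<in>plus_part A B r. class_dominated c a r \<one>)" if Gv: "(G, v) \<in> c" for G v
    proof -
      interpret V: rsv A G v using Sprv_set_reified[OF c Gv] is_cring by (simp add: rsv_iff)
      have "le0 G (v a) (Some (reify G r)) \<longleftrightarrow> class_dominated c a r \<one>"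
        if "0 < r" "a \<in> plus_part A B r" for a r
        using that plus_part_carrier[of r B] class_dominated_iff[OF is_cring c Gv, of a \<one> r]
        by (auto simp: dominated_def V.G.reify_closed)
      then show ?thesis by blast
    qed
    obtain G v where Gv: "(G, v) \<in> c" by (rule Sprv_set_nonempty[OF c])
    \<comment> \<open>With the empty set in place of \<open>B\<close> the plus parts are empty, and
      \<open>ad\<close> becomes a criterion for commensurability alone.\<close>
    have "commensurable_rsv A H w \<longleftrightarrow> commensurable_rsv A G v" if "(H, w) \<in> c" for H w
      using ad[OF that, of "{}"] ad[OF Gv, of "{}"] by (simp add: plus_part_def)
    then have "(\<exists>(H, w)\<in>c. commensurable_rsv A H w) \<longleftrightarrow> commensurable_rsv A G v"
      by (rule Sprv_set_ex_iff[OF c])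
    moreover have "(\<exists>(H, w)\<in>c. \<forall>r>0. \<forall>a\<in>plus_part A B r. le0 H (w a) (Some (reify H r))) \<longleftrightarrow>
        (\<forall>r>0. \<forall>a\<in>plus_part A B r. class_dominated c a r \<one>)"
      by (rule Sprv_set_ex_iff[OF c plus])
    ultimately show ?thesis by (simp add: ad[OF Gv] plus[OF Gv])
  qed
  then show ?thesis unfolding Spra_def Comm_def by (auto simp: topspace_Sprv)
qed

lemma openin_Spra_iff:
  "openin (Spra A B) U \<longleftrightarrow> (\<exists>W. openin (Sprv A) W \<and> U = W \<inter> topspace (Spra A B))"
proof -
  obtain Z where Z: "Spra A B = subtopology (Sprv A) Z"
    unfolding Spra_def Comm_def subtopology_subtopology by blast
  have "W \<inter> Z = W \<inter> topspace (Spra A B)" if "openin (Sprv A) W" for W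
    using openin_subset[OF that] unfolding Z by auto
  then show ?thesis unfolding Z openin_subtopology by (metis Z)
qed

section \<open>Rational subspaces\<close>

text \<open>The data are a denominator and a set of pairs of numerator and constant instead of an
  indexed family: the products of two families are then the image of a Cartesian product, with no
  renumbering.\<close>

definition rational :: "(real \<Rightarrow> 'a set) set \<Rightarrow> 'a \<Rightarrow> ('a \<times> real) set \<Rightarrow> 'a small_rsv set set" where
  "rational B b P = {c \<in> topspace (Spra A B). \<forall>(a, q)\<in>P. class_dominated c a q b}"

definition rational_data :: "('a \<times> real) set \<Rightarrow> bool" where
  "rational_data P \<longleftrightarrow> finite P \<and> P \<subseteq> carrier A \<times> {0<..} \<and> Idl (fst ` P) = carrier A"

lemma rational_subspaces_eq:
  "rational_subspaces A B = {rational B b P | b P. b \<in> carrier A \<and> rational_data P}"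
proof -
  have eq: "topspace (Spra A B) \<inter>
        {c \<in> Sprv_set A. \<exists>(G, v)\<in>c. \<forall>i\<in>{1..n}. dominated G v (f i) (q i) (f 0)} =
      rational B (f 0) ((\<lambda>i. (f i, q i)) ` {1..n})"
    if f: "f \<in> {0..n} \<rightarrow> carrier A" and q: "\<forall>i\<in>{1..n}. 0 < q i" for n :: nat and f q
  proof -
    have "(\<exists>(G, v)\<in>c. \<forall>i\<in>{1..n}. dominated G v (f i) (q i) (f 0)) \<longleftrightarrow>
        (\<forall>i\<in>{1..n}. class_dominated c (f i) (q i) (f 0))" if c: "c \<in> Sprv_set A" for c
    proof (rule Sprv_set_ex_iff[OF c])
      show "(\<forall>i\<in>{1..n}. dominated G v (f i) (q i) (f 0)) \<longleftrightarrow>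
          (\<forall>i\<in>{1..n}. class_dominated c (f i) (q i) (f 0))" if Gv: "(G, v) \<in> c" for G v
        using class_dominated_iff[OF is_cring c Gv] f q by (intro ball_cong) (auto simp: Pi_iff)
    qed
    then show ?thesis by (auto simp: rational_def topspace_Spra)
  qed
  show ?thesis
  proof (intro equalityI subsetI)
    fix R assume "R \<in> rational_subspaces A B"
    then obtain n :: nat and f q where f: "f \<in> {0..n} \<rightarrow> carrier A" "Idl (f ` {1..n}) = carrier A"
        "\<forall>i\<in>{1..n}. 0 < q i"
      and R: "R = topspace (Spra A B) \<inter>
        {c \<in> Sprv_set A. \<exists>(G, v)\<in>c. \<forall>i\<in>{1..n}. dominated G v (f i) (q i) (f 0)}"
      unfolding rational_subspaces_def by blast
    have "rational_data ((\<lambda>i. (f i, q i)) ` {1..n})"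
      using f by (auto simp: rational_data_def image_image Pi_iff)
    moreover have "f 0 \<in> carrier A" using f by auto
    ultimately show "R \<in> {rational B b P | b P. b \<in> carrier A \<and> rational_data P}"
      unfolding R eq[OF f(1,3)] by blast
  next
    fix R assume "R \<in> {rational B b P | b P. b \<in> carrier A \<and> rational_data P}"
    then obtain b P where b: "b \<in> carrier A" and P: "finite P" "P \<subseteq> carrier A \<times> {0<..}"
        "Idl (fst ` P) = carrier A" and R: "R = rational B b P"
      by (auto simp: rational_data_def)
    obtain h where h: "bij_betw h {1..card P} P" using ex_bij_betw_nat_finite_1[OF P(1)] by blast
    define f where "f i = (if i = 0 then b else fst (h i))" for i
    have hP: "h ` {1..card P} = P" using h by (simp add: bij_betw_def)
    have "(\<lambda>i. (f i, snd (h i))) ` {1..card P} = h ` {1..card P}"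
      by (rule image_cong) (auto simp: f_def)
    then have im: "(\<lambda>i. (f i, snd (h i))) ` {1..card P} = P" by (simp only: hP)
    have fst: "f ` {1..card P} = fst ` P"
      using arg_cong[OF im, of "image fst"] by (simp add: image_image)
    have mem: "h i \<in> carrier A \<times> {0<..}" if "i \<in> {1..card P}" for i
      using hP P(2) that by blast
    have f: "f \<in> {0..card P} \<rightarrow> carrier A"
    proof
      fix i assume "i \<in> {0..card P}"
      then show "f i \<in> carrier A" using mem[of i] b by (cases "i = 0") (auto simp: f_def mem_Times_iff)
    qed
    have q: "\<forall>i\<in>{1..card P}. 0 < snd (h i)" using mem by (auto simp: mem_Times_iff)
    have "R = topspace (Spra A B) \<inter>
        {c \<in> Sprv_set A. \<exists>(G, v)\<in>c. \<forall>i\<in>{1..card P}. dominated G v (f i) (snd (h i)) (f 0)}"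
      unfolding eq[OF f q] im R by (simp add: f_def)
    then show "R \<in> rational_subspaces A B"
      unfolding rational_subspaces_def using f q P(3) fst
      by (intro CollectI exI[of _ "card P"] exI[of _ f] exI[of _ "\<lambda>i. snd (h i)"]) simp
  qed
qed

lemma openin_rational:
  assumes "b \<in> carrier A" "finite P" "P \<subseteq> carrier A \<times> {0<..}"
  shows "openin (Spra A B) (rational B b P)"
proof -
  have "openin (Sprv A) (topspace (Sprv A) \<inter> (\<Inter>(a, q)\<in>P. {c \<in> Sprv_set A. class_dominated c a q b}))"
    using assms(2,3)
  proof (induction P rule: finite_induct)
    case (insert p P)
    obtain a q where p: "p = (a, q)" "a \<in> carrier A" "0 < q" using insert.prems by auto
    have "openin (Sprv A) ({c \<in> Sprv_set A. class_dominated c a q b} \<inter>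
        (topspace (Sprv A) \<inter> (\<Inter>(a, q)\<in>P. {c \<in> Sprv_set A. class_dominated c a q b})))"
      using insert.IH insert.prems p assms(1) by (intro openin_Int[OF openin_Sprv_generator]) auto
    then show ?case by (simp add: p(1) Int_left_commute)
  qed simp
  moreover have "rational B b P = topspace (Sprv A) \<inter>
      (\<Inter>(a, q)\<in>P. {c \<in> Sprv_set A. class_dominated c a q b}) \<inter> topspace (Spra A B)"
    by (auto simp: rational_def topspace_Spra topspace_Sprv)
  ultimately show ?thesis unfolding openin_Spra_iff by blast
qed

text \<open>The description v(a) \<le> q v(b) \<noteq> 0 is not rational data if \<open>a\<close>
  generates a proper ideal. Commensurability at \<open>c\<close> gives a real \<open>r\<close> with
  1 \<le> r v(b); adjoining the pair (\<one>, r) makes the numerators generate the unit ideal and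
  keeps \<open>c\<close> inside, at the price that the neighbourhood depends on
  \<open>c\<close>.\<close>

lemma rational_nbhd_generator:
  assumes c: "c \<in> topspace (Spra A B)" and dom: "class_dominated c a q b"
    and a: "a \<in> carrier A" and b: "b \<in> carrier A" and q: "0 < q"
  shows "\<exists>R\<in>rational_subspaces A B. c \<in> R \<and> R \<subseteq> {c \<in> Sprv_set A. class_dominated c a q b}"
proof -
  have cS: "c \<in> Sprv_set A" and ad: "adic_relation B (class_dominated c)" using c by (auto simp: topspace_Spra)
  obtain G v where Gv: "(G, v) \<in> c" by (rule Sprv_set_nonempty[OF cS])
  interpret V: rsv A G v using Sprv_set_reified[OF cS Gv] is_cring by (simp add: rsv_iff)
  note iff = class_dominated_iff[OF is_cring cS Gv]
  have "class_dominated c b 1 b" using dom a b q by (simp add: iff V.dominated_refl_iff V.dominated_nonzero[of a q b])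
  then obtain r where r: "0 < r" "class_dominated c \<one> r b" using ad b by (auto simp: adic_relation_def)
  have "\<one> \<in> Idl {a, \<one>}" using genideal_self[of "{a, \<one>}"] a by auto
  then have "Idl {a, \<one>} = carrier A" using ideal.one_imp_carrier[OF genideal_ideal[of "{a, \<one>}"]] a by auto
  then have "rational_data {(a, q), (\<one>, r)}" using a q r by (auto simp: rational_data_def)
  then have "rational B b {(a, q), (\<one>, r)} \<in> rational_subspaces A B"
    unfolding rational_subspaces_eq using b by blast
  then show ?thesis
    by (rule bexI[rotated]) (use c dom r in \<open>auto simp: rational_def topspace_Spra\<close>)
qed

text \<open>For fixed \<open>t\<close> in \<open>T\<close>, the \<open>x\<close> with
  \<open>x \<otimes> t \<in> I\<close> form an ideal containing \<open>S\<close>, so \<one> is among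
  them and \<open>t\<close> lies in \<open>I\<close>. Hence \<open>I\<close> contains
  \<open>T\<close>.\<close>

lemma ideal_contains_products:
  assumes S: "S \<subseteq> carrier A" "Idl S = carrier A" and T: "T \<subseteq> carrier A" "Idl T = carrier A"
    and I: "ideal I A" and ST: "\<And>s t. s \<in> S \<Longrightarrow> t \<in> T \<Longrightarrow> s \<otimes> t \<in> I"
  shows "I = carrier A"
proof -
  interpret I: ideal I A by (rule I)
  have colon: "t \<in> I" if t: "t \<in> T" for t
  proof -
    have tA: "t \<in> carrier A" using t T by blast
    let ?J = "{x \<in> carrier A. x \<otimes> t \<in> I}"
    have "ideal ?J A"
    proof (rule idealI)
      show "ring A" by (rule ring_axioms)
      show "subgroup ?J (add_monoid A)"
        using tA by (intro add.subgroupI) (auto simp: l_distr l_minus a_inv_def[symmetric] intro!: exI[of _ \<zero>])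
      show "x \<otimes> a \<in> ?J" if "a \<in> ?J" "x \<in> carrier A" for a x
        using that tA I.I_l_closed[of "a \<otimes> t" x] by (simp add: m_assoc)
      show "a \<otimes> x \<in> ?J" if "a \<in> ?J" "x \<in> carrier A" for a x
        using that tA I.I_l_closed[of "a \<otimes> t" x] by (simp add: m_ac)
    qed
    moreover have "S \<subseteq> ?J" using S(1) ST t by auto
    ultimately have "carrier A \<subseteq> ?J" using genideal_minimal[of ?J S] S(2) by simp
    then have "\<one> \<otimes> t \<in> I" by blast
    then show ?thesis using tA by simp
  qed
  then have "carrier A \<subseteq> I" using genideal_minimal[OF I, of T] T(2) by auto
  then show ?thesis using I.a_subset by blast
qed

text \<open>Over the common denominator \<open>b \<otimes> b'\<close> the numerators are all
  products of numerators, where each denominator counts as a numerator with constant 1. The products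
  from \<open>P\<close> and \<open>P'\<close> already generate the unit ideal.\<close>

lemma rational_Int:
  assumes "R \<in> rational_subspaces A B" "R' \<in> rational_subspaces A B"
  shows "R \<inter> R' \<in> rational_subspaces A B"
proof -
  obtain b P where R: "R = rational B b P" "b \<in> carrier A" "rational_data P"
    using assms(1) unfolding rational_subspaces_eq by blast
  obtain b' P' where R': "R' = rational B b' P'" "b' \<in> carrier A" "rational_data P'"
    using assms(2) unfolding rational_subspaces_eq by blast
  let ?m = "\<lambda>((a, p), (a', p')). (a \<otimes> a', p * p')"
  \<comment> \<open>The pair (b, 1) only demands v(b) \<noteq> 0, and it supplies products of
    \<open>b\<close> with the numerators of the other family, from which \<open>b\<close> can be
    cancelled.\<close>
  define Q where "Q = insert (b, 1) P"
  define Q' where "Q' = insert (b', 1) P'"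
  define N where "N = ?m ` (Q \<times> Q')"
  have QA: "finite Q" "Q \<subseteq> carrier A \<times> {0<..}" "Idl (fst ` P) = carrier A" "fst ` P \<subseteq> carrier A" "P \<subseteq> Q"
    using R by (auto simp: rational_data_def Q_def)
  have QA': "finite Q'" "Q' \<subseteq> carrier A \<times> {0<..}" "Idl (fst ` P') = carrier A" "fst ` P' \<subseteq> carrier A" "P' \<subseteq> Q'"
    using R' by (auto simp: rational_data_def Q'_def)
  have NA: "N \<subseteq> carrier A \<times> {0<..}" using QA(2) QA'(2) by (fastforce simp: N_def)
  then have fN: "fst ` N \<subseteq> carrier A" by auto
  have mN: "(a \<otimes> a', p * p') \<in> N" if "(a, p) \<in> Q" "(a', p') \<in> Q'" for a p a' p'
    unfolding N_def using that by (force intro: rev_image_eqI)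
  have "Idl (fst ` N) = carrier A"
  proof (rule ideal_contains_products[OF QA(4,3) QA'(4,3) genideal_ideal[OF fN]])
    fix s t assume "s \<in> fst ` P" "t \<in> fst ` P'"
    then obtain p p' where "(s, p) \<in> P" "(t, p') \<in> P'" by auto
    from mN[OF subsetD[OF QA(5) this(1)] subsetD[OF QA'(5) this(2)]] have "s \<otimes> t \<in> fst ` N" by force
    then show "s \<otimes> t \<in> Idl (fst ` N)" using genideal_self[OF fN] by blast
  qed
  then have "rational_data N" using QA(1) QA'(1) NA by (auto simp: rational_data_def N_def)
  moreover have "c \<in> R \<inter> R' \<longleftrightarrow> c \<in> rational B (b \<otimes> b') N" for c
  proof (cases "c \<in> topspace (Spra A B)")
    case True
    then have cS: "c \<in> Sprv_set A" by (simp add: topspace_Spra)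
    obtain G v where Gv: "(G, v) \<in> c" by (rule Sprv_set_nonempty[OF cS])
    interpret V: rsv A G v using Sprv_set_reified[OF cS Gv] is_cring by (simp add: rsv_iff)
    \<comment> \<open>A ring with a semivaluation is nonzero, so a family generating the unit ideal
      is nonempty. Its conditions therefore force a nonzero denominator; otherwise adjoining (b, 1)
      could change the set.\<close>
    have ne: "P \<noteq> {}" if "Idl (fst ` P) = carrier A" for P :: "('a \<times> real) set"
    proof
      assume "P = {}"
      then have "Idl {} = carrier A" using that by simp
      moreover have "Idl {} \<subseteq> {\<zero>}" by (rule genideal_minimal[OF zeroideal]) simp
      ultimately show False using V.one_neq_zero one_closed by blast
    qed
    have in_R: "c \<in> rational B d S \<longleftrightarrow> (\<forall>(a, q)\<in>S. V.D a q d)"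
      if d: "d \<in> carrier A" and S: "S \<subseteq> carrier A \<times> {0<..}" for d S
    proof -
      have "class_dominated c a q d \<longleftrightarrow> V.D a q d" if "(a, q) \<in> S" for a q
        using subsetD[OF S that] class_dominated_iff[OF is_cring cS Gv _ d] by simp
      then have "(\<forall>(a, q)\<in>S. class_dominated c a q d) \<longleftrightarrow> (\<forall>(a, q)\<in>S. V.D a q d)" by fast
      then show ?thesis using True by (simp add: rational_def)
    qed
    have Q: "(\<forall>(a, p)\<in>P. V.D a p b) \<longleftrightarrow> (\<forall>(a, p)\<in>Q. V.D a p b)"
      using ne[OF QA(3)] R(2) V.dominated_refl_iff[of b] V.dominated_nonzero
      by (fastforce simp: Q_def)
    have Q': "(\<forall>(a, p)\<in>P'. V.D a p b') \<longleftrightarrow> (\<forall>(a, p)\<in>Q'. V.D a p b')"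
      using ne[OF QA'(3)] R'(2) V.dominated_refl_iff[of b'] V.dominated_nonzero
      by (fastforce simp: Q'_def)
    have "(\<forall>(a, p)\<in>Q. V.D a p b) \<and> (\<forall>(a, p)\<in>Q'. V.D a p b') \<longleftrightarrow> (\<forall>(a, q)\<in>N. V.D a q (b \<otimes> b'))"
    proof
      assume *: "(\<forall>(a, p)\<in>Q. V.D a p b) \<and> (\<forall>(a, p)\<in>Q'. V.D a p b')"
      show "\<forall>(a, q)\<in>N. V.D a q (b \<otimes> b')"
      proof (clarsimp simp: N_def)
        fix a p a' p' assume "(a, p) \<in> Q" "(a', p') \<in> Q'"
        then show "V.D (a \<otimes> a') (p * p') (b \<otimes> b')"
          using * QA(2) QA'(2) R(2) R'(2) by (intro V.dominated_mult) auto
      qed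
    next
      assume N: "\<forall>(a, q)\<in>N. V.D a q (b \<otimes> b')"
      \<comment> \<open>Pairing with (b', 1) gives v(a b') \<le> p v(b b'), from which
        \<open>b'\<close> cancels.\<close>
      have 1: "V.D a p b" if "(a, p) \<in> Q" for a p
      proof -
        have "V.D (a \<otimes> b') (p * 1) (b \<otimes> b')" using N mN[OF that, of b' 1] by (auto simp: Q'_def)
        then show ?thesis using V.dominated_cancel[of a b b' p] that QA(2) R(2) R'(2) by auto
      qed
      have 2: "V.D a p b'" if "(a, p) \<in> Q'" for a p
      proof -
        have "V.D (b \<otimes> a) (1 * p) (b \<otimes> b')" using N mN[OF _ that, of b 1] by (auto simp: Q_def)
        then show ?thesis using V.dominated_cancel[of a b' b p] that QA'(2) R(2) R'(2) m_comm[of b] by auto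
      qed
      show "(\<forall>(a, p)\<in>Q. V.D a p b) \<and> (\<forall>(a, p)\<in>Q'. V.D a p b')" using 1 2 by blast
    qed
    then show ?thesis
      unfolding R(1) R'(1) using in_R R(2,3) R'(2,3) NA Q Q' by (simp add: rational_data_def)
  qed (simp add: R R' rational_def)
  ultimately show ?thesis unfolding rational_subspaces_eq using R(2) R'(2) by blast
qed

lemma rational_nbhd:
  assumes "openin (Spra A B) U" "c \<in> U"
  obtains R where "R \<in> rational_subspaces A B" "c \<in> R" "R \<subseteq> U"
proof -
  let ?X = "topspace (Spra A B)"
  obtain W where W: "openin (Sprv A) W" "U = W \<inter> ?X" using assms(1) by (auto simp: openin_Spra_iff)
  have "generate_topology_on
      {{c \<in> Sprv_set A. class_dominated c a q b} | a b q. a \<in> carrier A \<and> b \<in> carrier A \<and> 0 < q} W"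
    using W(1) unfolding Sprv_def openin_topology_generated_by_iff class_dominated_def .
  then have "\<exists>R\<in>rational_subspaces A B. c \<in> R \<and> R \<subseteq> W" if "c \<in> W \<inter> ?X" for c
    using that
  proof (induction arbitrary: c)
    case (Int W W')
    then have "c \<in> W \<inter> ?X" "c \<in> W' \<inter> ?X" by blast+
    from Int.IH(1)[OF this(1)] Int.IH(2)[OF this(2)]
    obtain R R' where "R \<in> rational_subspaces A B" "c \<in> R" "R \<subseteq> W"
      "R' \<in> rational_subspaces A B" "c \<in> R'" "R' \<subseteq> W'" by blast
    then show ?case using rational_Int by (intro bexI[of _ "R \<inter> R'"]) auto
  next
    case (UN K)
    then obtain W where "W \<in> K" "c \<in> W \<inter> ?X" by blast
    from this(1) UN.IH[OF this] show ?case by blast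
  next
    case (Basis W)
    then obtain a b q where "W = {c \<in> Sprv_set A. class_dominated c a q b}"
      "a \<in> carrier A" "b \<in> carrier A" "0 < q" by blast
    then show ?case using rational_nbhd_generator[of c B a q b] Basis.prems by blast
  qed simp
  then obtain R where R: "R \<in> rational_subspaces A B" "c \<in> R" "R \<subseteq> W" using assms(2) W(2) by blast
  moreover have "R \<subseteq> ?X" using R(1) by (auto simp: rational_subspaces_def)
  ultimately show thesis using W(2) by (intro that) auto
qed

lemma rational_base: "openin (Spra A B) = arbitrary union_of (\<lambda>U. U \<in> rational_subspaces A B)"
proof
  fix U
  show "openin (Spra A B) U = (arbitrary union_of (\<lambda>U. U \<in> rational_subspaces A B)) U"
  proof
    assume U: "openin (Spra A B) U"
    have "\<Union>{R \<in> rational_subspaces A B. R \<subseteq> U} = U" using rational_nbhd[OF U] by blast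
    then show "(arbitrary union_of (\<lambda>U. U \<in> rational_subspaces A B)) U"
      unfolding union_of_def arbitrary_def
      by (intro exI[of _ "{R \<in> rational_subspaces A B. R \<subseteq> U}"]) auto
  next
    assume "(arbitrary union_of (\<lambda>U. U \<in> rational_subspaces A B)) U"
    then obtain \<U> where \<U>: "\<U> \<subseteq> rational_subspaces A B" "U = \<Union>\<U>" by (auto simp: union_of_def)
    have "openin (Spra A B) R" if "R \<in> rational_subspaces A B" for R
      using that unfolding rational_subspaces_eq by (auto simp: rational_data_def intro: openin_rational)
    then show "openin (Spra A B) U" using \<U> by auto
  qed
qed

section \<open>Separation of points and ultrafilter limits in the spectrum\<close>

text \<open>Distinct classes differ in some instance of domination, since that relation determines
  the class. A rational neighbourhood inside the corresponding generating set then contains just one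
  of the two points.\<close>

lemma rational_separating:
  assumes "c \<in> topspace (Spra A B)" "c' \<in> topspace (Spra A B)" "c \<noteq> c'"
  shows "\<exists>R\<in>rational_subspaces A B. (c \<in> R) \<noteq> (c' \<in> R)"
proof -
  have cS: "c \<in> Sprv_set A" "c' \<in> Sprv_set A" using assms by (auto simp: topspace_Spra)
  have "\<exists>a\<in>carrier A. \<exists>b\<in>carrier A. \<exists>q>0. class_dominated c a q b \<noteq> class_dominated c' a q b"
  proof (rule ccontr)
    assume eq: "\<not> ?thesis"
    obtain G v where Gv: "(G, v) \<in> c" by (rule Sprv_set_nonempty[OF cS(1)])
    obtain H w where Hw: "(H, w) \<in> c'" by (rule Sprv_set_nonempty[OF cS(2)])
    have rs: "reified_semivaluation A G v" "reified_semivaluation A H w"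
      by (rule Sprv_set_reified[OF cS(1) Gv], rule Sprv_set_reified[OF cS(2) Hw])
    have "rsv_equivalent A G v H w"
    proof (rule equivalent_if_dominated_eq[OF is_cring rs])
      fix a b and q :: real assume ab: "a \<in> carrier A" "b \<in> carrier A" "0 < q"
      then have "class_dominated c a q b \<longleftrightarrow> class_dominated c' a q b" using eq by blast
      then show "dominated G v a q b \<longleftrightarrow> dominated H w a q b"
        by (simp add: class_dominated_iff[OF is_cring cS(1) Gv ab] class_dominated_iff[OF is_cring cS(2) Hw ab])
    qed
    then have "((G, v), (H, w)) \<in> rsv_rel A" using rs by (simp add: rsv_rel_def small_rsvs_def)
    then have "c = c'"
      using quotient_eqI[OF equiv_rsv_rel cS[unfolded Sprv_set_def] Gv Hw] by blast
    then show False using assms(3) by blast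
  qed
  then obtain a b q where abq: "a \<in> carrier A" "b \<in> carrier A" "0 < q"
    and "class_dominated c a q b \<noteq> class_dominated c' a q b" by blast
  then consider "class_dominated c a q b" "\<not> class_dominated c' a q b"
    | "class_dominated c' a q b" "\<not> class_dominated c a q b" by blast
  then show ?thesis
  proof cases
    case 1
    then show ?thesis using rational_nbhd_generator[OF assms(1) 1(1) abq] by blast
  next
    case 2
    then show ?thesis using rational_nbhd_generator[OF assms(2) 2(1) abq] by blast
  qed
qed

lemma rational_ultra_limit:
  assumes F: "ultrafilter F" and FX: "\<forall>\<^sub>F c in F. c \<in> topspace (Spra A B)"
  shows "\<exists>c\<in>topspace (Spra A B). \<forall>R\<in>rational_subspaces A B. (\<forall>\<^sub>F d in F. d \<in> R) \<longleftrightarrow> c \<in> R"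
proof -
  interpret F: ultrafilter F by (rule F)
  define G where "G = (\<lambda>c :: 'a small_rsv set. fst (SOME x. x \<in> c))"
  define v where "v = (\<lambda>c :: 'a small_rsv set. snd (SOME x. x \<in> c))"
  have Gv: "(G c, v c) \<in> c" if c: "c \<in> Sprv_set A" for c
  proof -
    obtain H w where "(H, w) \<in> c" by (rule Sprv_set_nonempty[OF c])
    then show ?thesis unfolding G_def v_def by (simp add: someI[of "\<lambda>x. x \<in> c"])
  qed
  have dom: "class_dominated c a q b \<longleftrightarrow> dominated (G c) (v c) a q b"
    if "c \<in> topspace (Spra A B)" "a \<in> carrier A" "b \<in> carrier A" "0 < q" for c a q b
    using class_dominated_iff[OF is_cring _ Gv] that by (simp add: topspace_Spra)
  have ev_dom: "\<forall>\<^sub>F c in F. class_dominated c a q b \<longleftrightarrow> dominated (G c) (v c) a q b"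
    if "a \<in> carrier A" "b \<in> carrier A" "0 < q" for a q b
    using FX by eventually_elim (rule dom[OF _ that])
  interpret M: rsv_ultraproduct A F G v
  proof unfold_locales
    show "\<forall>\<^sub>F c in F. rsv A (G c) (v c)"
      using FX by eventually_elim (use is_cring Sprv_set_reified[OF _ Gv] in \<open>auto simp: rsv_iff topspace_Spra\<close>)
    show "\<exists>s>0. \<forall>\<^sub>F c in F. dominated (G c) (v c) a s \<one>" if a: "a \<in> carrier A" for a
    proof (intro exI conjI)
      \<comment> \<open>The seminorm gives a bound that is uniform over all points, which is what
        the ultraproduct asks for.\<close>
      show pos: "0 < seminorm A a + 1" using seminorm_nonneg[OF a] by simp
      show "\<forall>\<^sub>F c in F. dominated (G c) (v c) a (seminorm A a + 1) \<one>"
        using FX ev_dom[OF a one_closed pos]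
        by eventually_elim (use a adic_relation_bounded in \<open>auto simp: topspace_Spra\<close>)
    qed
  qed
  have lim: "reified_semivaluation A M.U M.limit_rsv"
    using M.rsv_limit is_cring by (simp add: rsv_iff)
  \<comment> \<open>The limit has functions as values; an equivalent semivaluation of the small type
    is needed to obtain an element of \<open>Sprv_set A\<close>.\<close>
  obtain H and w :: "'a \<Rightarrow> (real \<times> 'a \<times> 'a) option"
    where Hw: "reified_semivaluation A H w" "rsv_equivalent A M.U M.limit_rsv H w"
    using rsv_small_representative[OF is_cring lim] by blast
  define c where "c = rsv_rel A `` {(H, w)}"
  have small: "(H, w) \<in> small_rsvs A" using Hw(1) by (simp add: small_rsvs_def)
  have cS: "c \<in> Sprv_set A" unfolding c_def Sprv_set_def by (rule quotientI[OF small])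
  have Hwc: "(H, w) \<in> c" unfolding c_def by (rule equiv_class_self[OF equiv_rsv_rel small])
  have c_dom: "class_dominated c a q b \<longleftrightarrow> M.noninf b \<and> (\<forall>\<^sub>F d in F. class_dominated d a q b)"
    if "a \<in> carrier A" "b \<in> carrier A" "0 < q" for a q b
    using class_dominated_iff[OF is_cring cS Hwc that] dominated_equivalent[OF is_cring lim Hw that]
      M.limit_rsv_dominated[OF that] eventually_subst[OF ev_dom[OF that]] by simp
  have "adic_relation B (class_dominated c)"
    unfolding adic_relation_def
  proof (intro conjI allI ballI impI)
    fix r :: real and a assume r: "0 < r" and a: "a \<in> top_nilpotent A r \<union> plus_part A B r"
    have "\<forall>\<^sub>F d in F. class_dominated d a r \<one>"
      using FX by eventually_elim (use r a in \<open>auto simp: topspace_Spra adic_relation_def\<close>)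
    then show "class_dominated c a r \<one>"
      using c_dom[of a \<one> r] a r plus_part_carrier M.noninf_one by blast
  next
    fix a assume a: "a \<in> carrier A" "class_dominated c a 1 a"
    \<comment> \<open>A nonzero value in the limit means \<open>noninf a\<close>, and the definition
      of \<open>noninf\<close> supplies the real that commensurability asks for.\<close>
    then have "M.noninf a" using c_dom[of a a 1] by simp
    then obtain r where r: "0 < r" "\<forall>\<^sub>F d in F. dominated (G d) (v d) \<one> r a" by (auto simp: M.noninf_def)
    then have "class_dominated c \<one> r a"
      using c_dom[OF one_closed a(1) r(1)] \<open>M.noninf a\<close> eventually_subst[OF ev_dom[OF one_closed a(1) r(1)]]
      by simp
    then show "\<exists>r>0. class_dominated c \<one> r a" using r(1) by blast
  qed
  then have cX: "c \<in> topspace (Spra A B)" using cS by (simp add: topspace_Spra)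
  moreover have "(\<forall>\<^sub>F d in F. d \<in> R) \<longleftrightarrow> c \<in> R" if "R \<in> rational_subspaces A B" for R
  proof -
    obtain b P where R: "R = rational B b P" and b: "b \<in> carrier A" and P: "rational_data P"
      using \<open>R \<in> _\<close> unfolding rational_subspaces_eq by blast
    have PA: "finite P" "P \<subseteq> carrier A \<times> {0<..}" "Idl (fst ` P) = carrier A"
      using P by (auto simp: rational_data_def)
    have c_P: "class_dominated c (fst x) (snd x) b \<longleftrightarrow>
        M.noninf b \<and> (\<forall>\<^sub>F d in F. class_dominated d (fst x) (snd x) b)" if "x \<in> P" for x
      using subsetD[OF PA(2) that] b by (intro c_dom) auto
    have "\<forall>\<^sub>F d in F. d \<in> R \<longleftrightarrow> (\<forall>x\<in>P. class_dominated d (fst x) (snd x) b)"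
      using FX by eventually_elim (auto simp: R rational_def)
    then have "(\<forall>\<^sub>F d in F. d \<in> R) \<longleftrightarrow> (\<forall>\<^sub>F d in F. \<forall>x\<in>P. class_dominated d (fst x) (snd x) b)"
      by (rule eventually_subst)
    also have "\<dots> \<longleftrightarrow> (\<forall>x\<in>P. \<forall>\<^sub>F d in F. class_dominated d (fst x) (snd x) b)"
      by (rule eventually_ball_finite_distrib[OF PA(1)])
    also have "\<dots> \<longleftrightarrow> (\<forall>x\<in>P. class_dominated c (fst x) (snd x) b)"
    proof
      assume *: "\<forall>x\<in>P. \<forall>\<^sub>F d in F. class_dominated d (fst x) (snd x) b"
      \<comment> \<open>For empty \<open>P\<close> the goal is vacuous; otherwise the unit ideal
        condition keeps v(b) away from zero, so that the extra conjunct in \<open>c_dom\<close> is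
        satisfied.\<close>
      have "M.noninf b" if "P \<noteq> {}"
      proof (rule M.noninf_of_unit_ideal[OF _ _ PA(3) b])
        show "fst ` P \<subseteq> carrier A" "fst ` P \<noteq> {}" using PA(2) that by auto
        fix a assume "a \<in> fst ` P"
        then obtain q where q: "(a, q) \<in> P" by auto
        then have "a \<in> carrier A" "0 < q" using PA(2) by auto
        moreover have "\<forall>\<^sub>F d in F. class_dominated d a q b" using * q by fastforce
        ultimately have "\<forall>\<^sub>F d in F. dominated (G d) (v d) a q b"
          using eventually_subst[OF ev_dom[of a b q]] b by simp
        then show "\<exists>r>0. \<forall>\<^sub>F d in F. dominated (G d) (v d) a r b" using \<open>0 < q\<close> by blast
      qed
      then show "\<forall>x\<in>P. class_dominated c (fst x) (snd x) b"
        using * c_P by blast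
    next
      assume "\<forall>x\<in>P. class_dominated c (fst x) (snd x) b"
      then show "\<forall>x\<in>P. \<forall>\<^sub>F d in F. class_dominated d (fst x) (snd x) b"
        using c_P by blast
    qed
    also have "\<dots> \<longleftrightarrow> c \<in> R" using cX by (auto simp: R rational_def)
    finally show ?thesis .
  qed
  ultimately show ?thesis by blast
qed

lemma spectral_base_Spra: "spectral_base (Spra A B) (rational_subspaces A B)"
  by unfold_locales (fact rational_base rational_Int rational_separating rational_ultra_limit)+

end

theorem theorem6p3:
  fixes A :: "('a, 'm) seminormed_ring_scheme" and B :: "(real \<Rightarrow> 'a set) set"
  assumes "affinoid_seminormed_ring A B"
  shows "spectral_space (Spra A B) \<and>
    openin (Spra A B) = arbitrary union_of (\<lambda>U. U \<in> rational_subspaces A B) \<and>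
    (\<forall>U\<in>rational_subspaces A B. openin (Spra A B) U \<and> compactin (Spra A B) U)"
proof -
  interpret affinoid_seminormed_ring A B by (rule assms)
  interpret spectral_base "Spra A B" "rational_subspaces A B" by (rule spectral_base_Spra)
  show ?thesis using spectral base base_open compactin_base by blast
qed

end
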